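(* Let $\kappa$ and $\kappa'$ be two parallel morphisms in the underlying object $Q$ of an iterated tensor of length $k$, $\overline{Q}=(Q,\overline{L_i},\overline{R_j})$. Suppose the 2-arrow diagram consisting of $\kappa$ and $\kappa'$ is formal, and suppose $\kappa$ and $\kappa'$ have underlying permutations that coincide. Then $\kappa=\kappa'$.
   Context: **Permutative categories.** A permutative category $C=(C,+,0,\beta)$ is a strict monoidal category $(C,+,0)$ with a natural isomorphism $\beta_{x,y}\colon x+y\to y+x$ such that $\beta_{y,x}\beta_{x,y}=1$ and $\beta_{x,y+z}=(1_y+\beta_{x,z})\circ(\beta_{x,y}+1_z)$. A symmetric monoidal functor $F$ is a functor with natural isomorphism $F_2\colon Fx+Fy\to F(x+y)$ and isomorphism $F_0\colon 0\to F0$ satisfying the usual associativity, unity and symmetry axioms; strict means $F_2,F_0$ are identities. **Tensor product.** For permutative categories $A,B$, start with the free strict monoidal category $\coprod_{n\ge 0}(A\times B)^n$ on $A\times B$, writing objects as finite formal sums $\sum a_i.b_i$ (the empty sum is $0$) and morphisms of $A\times B$ as $f.g$. Freely adjoin (in strict monoidal categories) isomorphisms $\delta^L_a(b,b')\colon a.b+a.b'\to a.(b+b')$, $\delta^R_b(a,a')\colon a.b+a'.b\to(a+a').b$, $\beta_{a.b,a'.b'}\colon a.b+a'.b'\to a'.b'+a.b$, $\zeta^L_a\colon 0\to a.0$, $\zeta^R_b\colon 0\to 0.b$ for all $a,a'\in A$, $b,b'\in B$. Impose the relations: (1) all of these are natural in every variable; (2) $\beta$ together with $+,0$ gives a permutative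 structure; (3) each $a.(-)$ is a symmetric monoidal functor with constraints $\delta^L_a,\zeta^L_a$ and each $(-).b$ is a symmetric monoidal functor with constraints $\delta^R_b,\zeta^R_b$; (4) $\delta^L_{a+a'}\circ(\delta^R_b+\delta^R_{b'})=\delta^R_{b+b'}\circ(\delta^L_a+\delta^L_{a'})\circ(1+\beta+1)$ as morphisms $a.b+a'.b+a.b'+a'.b'\to(a+a').(b+b')$; (5) $\zeta^L_0=\zeta^R_0\colon 0\to 0.0$; (6) $\delta^R_0(a,a')\circ(\zeta^L_a+\zeta^L_{a'})=\zeta^L_{a+a'}$ and $\delta^L_0(b,b')\circ(\zeta^R_b+\zeta^R_{b'})=\zeta^R_{b+b'}$. The result is the permutative category $A\otimes B$. For symmetric monoidal functors $F,G$, $F\otimes G$ is the strict symmetric monoidal functor with $a.b\mapsto Fa.Gb$, $f.g\mapsto Ff.Gg$, $\delta^L_a\mapsto(1.G_2)\circ\delta^L_{Fa}$, $\delta^R_b\mapsto(F_2.1)\circ\delta^R_{Gb}$, $\beta\mapsto\beta$, $\zeta^L_a\mapsto(1.G_0)\circ\zeta^L_{Fa}$, $\zeta^R_b\mapsto(F_0.1)\circ\zeta^R_{Gb}$. **Free permutative category.** For a category $X$, $\mathbf{P}X$ is the free permutative category on $X$: objects are finite formal sums $\sum x_i$ of objects of $X$, and morphisms are generated by sums $\sum f_i$ of morphisms of $X$ and symmetries $\beta$. **The functor $\Phi\colon\mathbf{P}X\otimes\mathbf{P}Y\to\mathbf{P}(X\times Y)$.** It is the strict symmetric monoidal functor with $(\sum_i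 x_i).(\sum_j y_j)\mapsto\sum_i\sum_j(x_i,y_j)$, $(\sum_i f_i).(\sum_j g_j)\mapsto\sum_i\sum_j(f_i,g_j)$ (value $0$ if either sum is empty); for $\beta\colon x_1+x_2\to x_2+x_1$ in $\mathbf{P}X$, $\beta.1$ on $(x_1+x_2).(\sum_j y_j)$ goes to the symmetry $\sum_j(x_1,y_j)+\sum_j(x_2,y_j)\to\sum_j(x_2,y_j)+\sum_j(x_1,y_j)$; for $\beta\colon y_1+y_2\to y_2+y_1$ in $\mathbf{P}Y$, $1.\beta$ on $(\sum_i x_i).(y_1+y_2)$ goes to $\sum_i\beta$; $\delta^L_{\sum x_i}$ goes to the symmetry $\sum_i\sum_j(x_i,y_j)+\sum_i\sum_k(x_i,y'_k)\to\sum_i\bigl(\sum_j(x_i,y_j)+\sum_k(x_i,y'_k)\bigr)$; $\beta\mapsto\beta$; and $\delta^R,\zeta^L,\zeta^R$ go to identities. **Iterated tensors.** An iterated tensor of length 1 is a permutative category $A$ (its own underlying object). An iterated tensor of length $k>1$ is a triple $\overline Q=(Q,\overline{L_i},\overline{R_j})$ where $\overline{L_i},\overline{R_j}$ are iterated tensors of lengths $i,j$ with $i+j=k$ and underlying objects $L_i,R_j$, and $Q=L_i\otimes R_j$ is the underlying object. For length 1: $(\mathbf{P}\,\mathrm{ob})(A)=\mathbf{P}(\mathrm{ob}A)$ with $\mathrm{ob}A$ discrete, $T(A)=\mathrm{ob}A$, $\chi\colon\mathbf{P}(\mathrm{ob}A)\to A$ is the strict symmetric monoidal functor induced by $\mathrm{ob}A\hookrightarrow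 A$, and $\Phi\colon(\mathbf{P}\,\mathrm{ob})(A)\to\mathbf{P}T(A)$ is the identity. For length $k>1$: $(\mathbf{P}\,\mathrm{ob})(\overline Q)$ is the iterated tensor with underlying object $(\mathbf{P}\,\mathrm{ob})(Q)=(\mathbf{P}\,\mathrm{ob})(L_i)\otimes(\mathbf{P}\,\mathrm{ob})(R_j)$ and factors $(\mathbf{P}\,\mathrm{ob})(\overline{L_i})$, $(\mathbf{P}\,\mathrm{ob})(\overline{R_j})$; $T(\overline Q)=T(\overline{L_i})\times T(\overline{R_j})$; $\chi=\chi\otimes\chi\colon(\mathbf{P}\,\mathrm{ob})(Q)\to Q$; and $\Phi\colon(\mathbf{P}\,\mathrm{ob})(Q)\to\mathbf{P}T(\overline Q)$ is the composite of $\Phi\otimes\Phi$ with $\Phi\colon\mathbf{P}T(\overline{L_i})\otimes\mathbf{P}T(\overline{R_j})\to\mathbf{P}(T(\overline{L_i})\times T(\overline{R_j}))$. **Formal diagrams.** A diagram $D\colon\mathbb D\to Q$ ($\mathbb D$ a small category) is formal if there is a lift $\widetilde D\colon\mathbb D\to(\mathbf{P}\,\mathrm{ob})(Q)$ with $D=\chi\circ\widetilde D$. A single morphism is regarded as a diagram indexed by $\{\bullet\to\bullet\}$. For two parallel morphisms $\kappa,\kappa'$, the 2-arrow diagram being formal means there are parallel morphisms $\widetilde\kappa,\widetilde\kappa'$ with $\chi\widetilde\kappa=\kappa$, $\chi\widetilde\kappa'=\kappa'$. An underlying permutation of a formal morphism $\kappa$ is a morphism of the form $\Phi(\widetilde\kappa)$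 in $\mathbf{P}T(\overline Q)$ for some lift $\widetilde\kappa$ of $\kappa$ in $(\mathbf{P}\,\mathrm{ob})(Q)$.
   Formalization: The coinciding underlying permutations are taken from the two members of one parallel lift of the 2-arrow diagram; with unrelated lifts of the two morphisms the claim fails. The length-1 constituents are permutative categories on subsets of common sets of objects and morphisms. *)

theory Defs
  imports Main
begin

section \<open>Categories, permutative categories, functors\<close>

record ('o, 'm) cat =
  Ob :: "'o set"
  Mor :: "'m set"
  Dom :: "'m \<Rightarrow> 'o"
  Cod :: "'m \<Rightarrow> 'o"
  Idm :: "'o \<Rightarrow> 'm"
  Cmp :: "'m \<Rightarrow> 'm \<Rightarrow> 'm"

record ('o, 'm) pcat = "('o, 'm) cat" +
  Plus :: "'o \<Rightarrow> 'o \<Rightarrow> 'o"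
  Zero :: "'o"
  PlusM :: "'m \<Rightarrow> 'm \<Rightarrow> 'm"
  Beta :: "'o \<Rightarrow> 'o \<Rightarrow> 'm"

text \<open>\<open>Cmp C g f\<close> is \<open>g \<circ> f\<close>. Operations are unconstrained off the carriers \<open>Ob\<close> and \<open>Mor\<close> (and,
  for composition, off the composable pairs).\<close>

locale category =
  fixes C :: "('o, 'm, 'z) cat_scheme"
  assumes dom_ob: "f \<in> Mor C \<Longrightarrow> Dom C f \<in> Ob C"
    and cod_ob: "f \<in> Mor C \<Longrightarrow> Cod C f \<in> Ob C"
    and id_mor: "x \<in> Ob C \<Longrightarrow> Idm C x \<in> Mor C"
    and id_dom: "x \<in> Ob C \<Longrightarrow> Dom C (Idm C x) = x"
    and id_cod: "x \<in> Ob C \<Longrightarrow> Cod C (Idm C x) = x"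
    and cmp_mor: "\<lbrakk>f \<in> Mor C; g \<in> Mor C; Dom C g = Cod C f\<rbrakk> \<Longrightarrow> Cmp C g f \<in> Mor C"
    and cmp_dom: "\<lbrakk>f \<in> Mor C; g \<in> Mor C; Dom C g = Cod C f\<rbrakk> \<Longrightarrow> Dom C (Cmp C g f) = Dom C f"
    and cmp_cod: "\<lbrakk>f \<in> Mor C; g \<in> Mor C; Dom C g = Cod C f\<rbrakk> \<Longrightarrow> Cod C (Cmp C g f) = Cod C g"
    and cmp_id_left: "f \<in> Mor C \<Longrightarrow> Cmp C (Idm C (Cod C f)) f = f"
    and cmp_id_right: "f \<in> Mor C \<Longrightarrow> Cmp C f (Idm C (Dom C f)) = f"
    and cmp_assoc: "\<lbrakk>f \<in> Mor C; g \<in> Mor C; h \<in> Mor C; Dom C g = Cod C f; Dom C h = Cod C g\<rbrakk>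
      \<Longrightarrow> Cmp C h (Cmp C g f) = Cmp C (Cmp C h g) f"

locale permutative = category C for C :: "('o, 'm, 'z) pcat_scheme" +
  assumes zero_ob: "Zero C \<in> Ob C"
    and plus_ob: "\<lbrakk>x \<in> Ob C; y \<in> Ob C\<rbrakk> \<Longrightarrow> Plus C x y \<in> Ob C"
    and plus_mor: "\<lbrakk>f \<in> Mor C; g \<in> Mor C\<rbrakk> \<Longrightarrow> PlusM C f g \<in> Mor C"
    and plus_dom: "\<lbrakk>f \<in> Mor C; g \<in> Mor C\<rbrakk> \<Longrightarrow> Dom C (PlusM C f g) = Plus C (Dom C f) (Dom C g)"
    and plus_cod: "\<lbrakk>f \<in> Mor C; g \<in> Mor C\<rbrakk> \<Longrightarrow> Cod C (PlusM C f g) = Plus C (Cod C f) (Cod C g)"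
    and plus_id: "\<lbrakk>x \<in> Ob C; y \<in> Ob C\<rbrakk> \<Longrightarrow> PlusM C (Idm C x) (Idm C y) = Idm C (Plus C x y)"
    and plus_cmp: "\<lbrakk>f \<in> Mor C; g \<in> Mor C; f' \<in> Mor C; g' \<in> Mor C;
        Dom C g = Cod C f; Dom C g' = Cod C f'\<rbrakk>
      \<Longrightarrow> PlusM C (Cmp C g f) (Cmp C g' f') = Cmp C (PlusM C g g') (PlusM C f f')"
    and plus_assoc: "\<lbrakk>x \<in> Ob C; y \<in> Ob C; z \<in> Ob C\<rbrakk>
      \<Longrightarrow> Plus C (Plus C x y) z = Plus C x (Plus C y z)"
    and zero_plus: "x \<in> Ob C \<Longrightarrow> Plus C (Zero C) x = x"
    and plus_zero: "x \<in> Ob C \<Longrightarrow> Plus C x (Zero C) = x"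
    and plusM_assoc: "\<lbrakk>f \<in> Mor C; g \<in> Mor C; h \<in> Mor C\<rbrakk>
      \<Longrightarrow> PlusM C (PlusM C f g) h = PlusM C f (PlusM C g h)"
    and zero_plusM: "f \<in> Mor C \<Longrightarrow> PlusM C (Idm C (Zero C)) f = f"
    and plusM_zero: "f \<in> Mor C \<Longrightarrow> PlusM C f (Idm C (Zero C)) = f"
    and beta_mor: "\<lbrakk>x \<in> Ob C; y \<in> Ob C\<rbrakk> \<Longrightarrow> Beta C x y \<in> Mor C"
    and beta_dom: "\<lbrakk>x \<in> Ob C; y \<in> Ob C\<rbrakk> \<Longrightarrow> Dom C (Beta C x y) = Plus C x y"
    and beta_cod: "\<lbrakk>x \<in> Ob C; y \<in> Ob C\<rbrakk> \<Longrightarrow> Cod C (Beta C x y) = Plus C y x"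
    and beta_nat: "\<lbrakk>f \<in> Mor C; g \<in> Mor C\<rbrakk>
      \<Longrightarrow> Cmp C (Beta C (Cod C f) (Cod C g)) (PlusM C f g)
        = Cmp C (PlusM C g f) (Beta C (Dom C f) (Dom C g))"
    and beta_inv: "\<lbrakk>x \<in> Ob C; y \<in> Ob C\<rbrakk>
      \<Longrightarrow> Cmp C (Beta C y x) (Beta C x y) = Idm C (Plus C x y)"
    and beta_plus: "\<lbrakk>x \<in> Ob C; y \<in> Ob C; z \<in> Ob C\<rbrakk>
      \<Longrightarrow> Beta C x (Plus C y z)
        = Cmp C (PlusM C (Idm C y) (Beta C x z)) (PlusM C (Beta C x y) (Idm C z))"

definition parallel :: "('o, 'm, 'z) cat_scheme \<Rightarrow> 'm \<Rightarrow> 'm \<Rightarrow> bool" where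
  "parallel C f g \<longleftrightarrow> f \<in> Mor C \<and> g \<in> Mor C \<and> Dom C f = Dom C g \<and> Cod C f = Cod C g"

definition inverse_mor :: "('o, 'm, 'z) cat_scheme \<Rightarrow> 'm \<Rightarrow> 'm" where
  "inverse_mor C f = (THE g. g \<in> Mor C \<and> Dom C g = Cod C f \<and> Cod C g = Dom C f
     \<and> Cmp C g f = Idm C (Dom C f) \<and> Cmp C f g = Idm C (Cod C f))"

definition sumM :: "('o, 'm, 'z) pcat_scheme \<Rightarrow> 'm list \<Rightarrow> 'm" where
  "sumM C fs = foldr (PlusM C) fs (Idm C (Zero C))"

definition discrete :: "'o set \<Rightarrow> ('o, 'o) cat" where
  "discrete S = \<lparr>Ob = S, Mor = S, Dom = (\<lambda>x. x), Cod = (\<lambda>x. x), Idm = (\<lambda>x. x), Cmp = (\<lambda>g f. f)\<rparr>"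

definition prod_cat :: "('o, 'm) cat \<Rightarrow> ('p, 'n) cat \<Rightarrow> ('o \<times> 'p, 'm \<times> 'n) cat" where
  "prod_cat X Y = \<lparr>Ob = Ob X \<times> Ob Y, Mor = Mor X \<times> Mor Y,
     Dom = map_prod (Dom X) (Dom Y), Cod = map_prod (Cod X) (Cod Y),
     Idm = map_prod (Idm X) (Idm Y),
     Cmp = (\<lambda>g f. (Cmp X (fst g) (fst f), Cmp Y (snd g) (snd f)))\<rparr>"

text \<open>Every symmetric monoidal functor below is strict, so a functor carries no constraint data.\<close>

record ('o, 'm, 'p, 'n) func =
  Fo :: "'o \<Rightarrow> 'p"
  Fm :: "'m \<Rightarrow> 'n"

definition comp_func ::
  "('p, 'n, 'q, 'l) func \<Rightarrow> ('o, 'm, 'p, 'n) func \<Rightarrow> ('o, 'm, 'q, 'l) func" (infixr "\<circ>\<^sub>F" 55) where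
  "G \<circ>\<^sub>F F = \<lparr>Fo = Fo G \<circ> Fo F, Fm = Fm G \<circ> Fm F\<rparr>"

text \<open>Renaming of objects and morphisms along maps injective on the carriers, with the two
  mutually inverse isomorphisms.\<close>

definition relabel ::
  "('o \<Rightarrow> 'p) \<Rightarrow> ('m \<Rightarrow> 'n) \<Rightarrow> ('o, 'm) pcat \<Rightarrow> ('p, 'n) pcat" where
  "relabel p q C = (let p' = inv_into (Ob C) p; q' = inv_into (Mor C) q in
     \<lparr>Ob = p ` Ob C, Mor = q ` Mor C,
      Dom = (\<lambda>f. p (Dom C (q' f))), Cod = (\<lambda>f. p (Cod C (q' f))),
      Idm = (\<lambda>x. q (Idm C (p' x))), Cmp = (\<lambda>g f. q (Cmp C (q' g) (q' f))),
      Plus = (\<lambda>x y. p (Plus C (p' x) (p' y))), Zero = p (Zero C),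
      PlusM = (\<lambda>f g. q (PlusM C (q' f) (q' g))), Beta = (\<lambda>x y. q (Beta C (p' x) (p' y)))\<rparr>)"

definition to_relabel :: "('o \<Rightarrow> 'p) \<Rightarrow> ('m \<Rightarrow> 'n) \<Rightarrow> ('o, 'm, 'p, 'n) func" where
  "to_relabel p q = \<lparr>Fo = p, Fm = q\<rparr>"

definition from_relabel ::
  "('o \<Rightarrow> 'p) \<Rightarrow> ('m \<Rightarrow> 'n) \<Rightarrow> ('o, 'm) pcat \<Rightarrow> ('p, 'n, 'o, 'm) func" where
  "from_relabel p q C = \<lparr>Fo = inv_into (Ob C) p, Fm = inv_into (Mor C) q\<rparr>"


section \<open>Permutative categories given by generators and relations\<close>

text \<open>Objects are finite formal sums (lists) of atoms; morphisms are formal composites and sums of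
  generating morphisms, identities and symmetries, modulo the congruence generated by the axioms of
  a permutative category and the given relations. Formal symmetries \<open>SymT u v\<close> are included for all
  sums \<open>u\<close>, \<open>v\<close>; the axiom for \<open>\<beta>\<^bsub>x,y+z\<^esub>\<close> and \<open>\<beta>\<^bsub>y,x\<^esub>\<beta>\<^bsub>x,y\<^esub> = 1\<close> express them by those on two atoms.\<close>

datatype ('x, 'g) pterm =
    GenT 'g
  | IdT "'x list"
  | SymT "'x list" "'x list"
  | CmpT "('x, 'g) pterm" "('x, 'g) pterm"
  | SumT "('x, 'g) pterm" "('x, 'g) pterm"

record ('x, 'g) presentation =
  Atoms :: "'x set"
  Gens :: "'g set"
  gdom :: "'g \<Rightarrow> 'x list"
  gcod :: "'g \<Rightarrow> 'x list"
  Rels :: "('x, 'g) pterm \<Rightarrow> ('x, 'g) pterm \<Rightarrow> bool"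

fun tdom :: "('x, 'g) presentation \<Rightarrow> ('x, 'g) pterm \<Rightarrow> 'x list" where
  "tdom P (GenT g) = gdom P g"
| "tdom P (IdT u) = u"
| "tdom P (SymT u v) = u @ v"
| "tdom P (CmpT s t) = tdom P t"
| "tdom P (SumT s t) = tdom P s @ tdom P t"

fun tcod :: "('x, 'g) presentation \<Rightarrow> ('x, 'g) pterm \<Rightarrow> 'x list" where
  "tcod P (GenT g) = gcod P g"
| "tcod P (IdT u) = u"
| "tcod P (SymT u v) = v @ u"
| "tcod P (CmpT s t) = tcod P s"
| "tcod P (SumT s t) = tcod P s @ tcod P t"

fun wft :: "('x, 'g) presentation \<Rightarrow> ('x, 'g) pterm \<Rightarrow> bool" where
  "wft P (GenT g) \<longleftrightarrow> g \<in> Gens P"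
| "wft P (IdT u) \<longleftrightarrow> u \<in> lists (Atoms P)"
| "wft P (SymT u v) \<longleftrightarrow> u \<in> lists (Atoms P) \<and> v \<in> lists (Atoms P)"
| "wft P (CmpT s t) \<longleftrightarrow> wft P s \<and> wft P t \<and> tdom P s = tcod P t"
| "wft P (SumT s t) \<longleftrightarrow> wft P s \<and> wft P t"

inductive teq :: "('x, 'g) presentation \<Rightarrow> ('x, 'g) pterm \<Rightarrow> ('x, 'g) pterm \<Rightarrow> bool"
  for P :: "('x, 'g) presentation" where
  teq_rel: "\<lbrakk>Rels P s t; wft P s; wft P t; tdom P s = tdom P t; tcod P s = tcod P t\<rbrakk> \<Longrightarrow> teq P s t"
| teq_refl: "wft P t \<Longrightarrow> teq P t t"
| teq_sym: "teq P s t \<Longrightarrow> teq P t s"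
| teq_trans: "\<lbrakk>teq P r s; teq P s t\<rbrakk> \<Longrightarrow> teq P r t"
| teq_cmp: "\<lbrakk>teq P s s'; teq P t t'; tdom P s = tcod P t\<rbrakk> \<Longrightarrow> teq P (CmpT s t) (CmpT s' t')"
| teq_sum: "\<lbrakk>teq P s s'; teq P t t'\<rbrakk> \<Longrightarrow> teq P (SumT s t) (SumT s' t')"
| teq_id_left: "wft P t \<Longrightarrow> teq P (CmpT (IdT (tcod P t)) t) t"
| teq_id_right: "wft P t \<Longrightarrow> teq P (CmpT t (IdT (tdom P t))) t"
| teq_assoc: "\<lbrakk>wft P r; wft P s; wft P t; tdom P r = tcod P s; tdom P s = tcod P t\<rbrakk>
    \<Longrightarrow> teq P (CmpT (CmpT r s) t) (CmpT r (CmpT s t))"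
| teq_sum_id: "\<lbrakk>u \<in> lists (Atoms P); v \<in> lists (Atoms P)\<rbrakk>
    \<Longrightarrow> teq P (SumT (IdT u) (IdT v)) (IdT (u @ v))"
| teq_interchange: "\<lbrakk>wft P s; wft P t; wft P s'; wft P t'; tdom P s = tcod P t; tdom P s' = tcod P t'\<rbrakk>
    \<Longrightarrow> teq P (SumT (CmpT s t) (CmpT s' t')) (CmpT (SumT s s') (SumT t t'))"
| teq_sum_assoc: "\<lbrakk>wft P r; wft P s; wft P t\<rbrakk>
    \<Longrightarrow> teq P (SumT (SumT r s) t) (SumT r (SumT s t))"
| teq_zero_left: "wft P t \<Longrightarrow> teq P (SumT (IdT []) t) t"
| teq_zero_right: "wft P t \<Longrightarrow> teq P (SumT t (IdT [])) t"
| teq_beta_nat: "\<lbrakk>wft P s; wft P t\<rbrakk>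
    \<Longrightarrow> teq P (CmpT (SymT (tcod P s) (tcod P t)) (SumT s t))
          (CmpT (SumT t s) (SymT (tdom P s) (tdom P t)))"
| teq_beta_inv: "\<lbrakk>u \<in> lists (Atoms P); v \<in> lists (Atoms P)\<rbrakk>
    \<Longrightarrow> teq P (CmpT (SymT v u) (SymT u v)) (IdT (u @ v))"
| teq_beta_plus: "\<lbrakk>u \<in> lists (Atoms P); v \<in> lists (Atoms P); w \<in> lists (Atoms P)\<rbrakk>
    \<Longrightarrow> teq P (SymT u (v @ w)) (CmpT (SumT (IdT v) (SymT u w)) (SumT (SymT u v) (IdT w)))"

definition cls :: "('x, 'g) presentation \<Rightarrow> ('x, 'g) pterm \<Rightarrow> ('x, 'g) pterm set" where
  "cls P t = {s. teq P s t}"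

definition rep :: "('x, 'g) pterm set \<Rightarrow> ('x, 'g) pterm" where
  "rep c = (SOME t. t \<in> c)"

definition presented ::
  "('x, 'g) presentation \<Rightarrow> ('x list, ('x, 'g) pterm set) pcat" where
  "presented P = \<lparr>Ob = lists (Atoms P), Mor = {cls P t | t. wft P t},
     Dom = (\<lambda>c. tdom P (rep c)), Cod = (\<lambda>c. tcod P (rep c)),
     Idm = (\<lambda>u. cls P (IdT u)), Cmp = (\<lambda>c d. cls P (CmpT (rep c) (rep d))),
     Plus = (@), Zero = [], PlusM = (\<lambda>c d. cls P (SumT (rep c) (rep d))),
     Beta = (\<lambda>u v. cls P (SymT u v))\<rparr>"

text \<open>The strict symmetric monoidal functor out of a presented permutative category determined by
  its values on atoms and on generating morphisms. It is only used for values that respect the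
  relations, and then does not depend on the representative.\<close>

definition ev_ob :: "('p, 'n, 'z) pcat_scheme \<Rightarrow> ('x \<Rightarrow> 'p) \<Rightarrow> 'x list \<Rightarrow> 'p" where
  "ev_ob D h u = foldr (\<lambda>x. Plus D (h x)) u (Zero D)"

fun ev :: "('p, 'n, 'z) pcat_scheme \<Rightarrow> ('x \<Rightarrow> 'p) \<Rightarrow> ('g \<Rightarrow> 'n) \<Rightarrow> ('x, 'g) pterm \<Rightarrow> 'n" where
  "ev D h k (GenT g) = k g"
| "ev D h k (IdT u) = Idm D (ev_ob D h u)"
| "ev D h k (SymT u v) = Beta D (ev_ob D h u) (ev_ob D h v)"
| "ev D h k (CmpT s t) = Cmp D (ev D h k s) (ev D h k t)"
| "ev D h k (SumT s t) = PlusM D (ev D h k s) (ev D h k t)"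

definition extend ::
  "('p, 'n, 'z) pcat_scheme \<Rightarrow> ('x \<Rightarrow> 'p) \<Rightarrow> ('g \<Rightarrow> 'n) \<Rightarrow> ('x list, ('x, 'g) pterm set, 'p, 'n) func" where
  "extend D h k = \<lparr>Fo = ev_ob D h, Fm = (\<lambda>c. ev D h k (rep c))\<rparr>"


section \<open>The free permutative category on a category\<close>

inductive free_rels :: "('o, 'm) cat \<Rightarrow> ('o, 'm) pterm \<Rightarrow> ('o, 'm) pterm \<Rightarrow> bool"
  for X :: "('o, 'm) cat" where
  "\<lbrakk>f \<in> Mor X; g \<in> Mor X; Dom X g = Cod X f\<rbrakk>
    \<Longrightarrow> free_rels X (GenT (Cmp X g f)) (CmpT (GenT g) (GenT f))"
| "x \<in> Ob X \<Longrightarrow> free_rels X (GenT (Idm X x)) (IdT [x])"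

definition free_pres :: "('o, 'm) cat \<Rightarrow> ('o, 'm) presentation" where
  "free_pres X = \<lparr>Atoms = Ob X, Gens = Mor X, gdom = (\<lambda>f. [Dom X f]), gcod = (\<lambda>f. [Cod X f]),
     Rels = free_rels X\<rparr>"

definition FreeP :: "('o, 'm) cat \<Rightarrow> ('o list, ('o, 'm) pterm set) pcat" where
  "FreeP X = presented (free_pres X)"

definition incl :: "('o, 'm) cat \<Rightarrow> 'm \<Rightarrow> ('o, 'm) pterm set" where
  "incl X f = cls (free_pres X) (GenT f)"

definition FreeP_map :: "('p, 'n) cat \<Rightarrow> ('o \<Rightarrow> 'p) \<Rightarrow> ('m \<Rightarrow> 'n) \<Rightarrow>
    ('o list, ('o, 'm) pterm set, 'p list, ('p, 'n) pterm set) func" where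
  "FreeP_map Y p q = extend (FreeP Y) (\<lambda>x. [p x]) (\<lambda>f. incl Y (q f))"


section \<open>The tensor product of permutative categories\<close>

text \<open>\<open>DL a b b'\<close> is \<open>\<delta>\<^sup>L\<^sub>a(b,b')\<close>, \<open>DR b a a'\<close> is \<open>\<delta>\<^sup>R\<^sub>b(a,a')\<close>, \<open>ZL a\<close> is \<open>\<zeta>\<^sup>L\<^sub>a\<close>, \<open>ZR b\<close> is \<open>\<zeta>\<^sup>R\<^sub>b\<close>;
  a trailing \<open>i\<close> marks the formal inverse.\<close>

datatype ('a, 'f, 'b, 'g) tgen =
    Ten 'f 'g
  | DL 'a 'b 'b | DLi 'a 'b 'b
  | DR 'b 'a 'a | DRi 'b 'a 'a
  | ZL 'a | ZLi 'a
  | ZR 'b | ZRi 'b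

fun tensor_gens :: "('a, 'f) pcat \<Rightarrow> ('b, 'g) pcat \<Rightarrow> ('a, 'f, 'b, 'g) tgen \<Rightarrow> bool" where
  "tensor_gens A B (Ten f g) \<longleftrightarrow> f \<in> Mor A \<and> g \<in> Mor B"
| "tensor_gens A B (DL a b b') \<longleftrightarrow> a \<in> Ob A \<and> b \<in> Ob B \<and> b' \<in> Ob B"
| "tensor_gens A B (DLi a b b') \<longleftrightarrow> a \<in> Ob A \<and> b \<in> Ob B \<and> b' \<in> Ob B"
| "tensor_gens A B (DR b a a') \<longleftrightarrow> b \<in> Ob B \<and> a \<in> Ob A \<and> a' \<in> Ob A"
| "tensor_gens A B (DRi b a a') \<longleftrightarrow> b \<in> Ob B \<and> a \<in> Ob A \<and> a' \<in> Ob A"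
| "tensor_gens A B (ZL a) \<longleftrightarrow> a \<in> Ob A"
| "tensor_gens A B (ZLi a) \<longleftrightarrow> a \<in> Ob A"
| "tensor_gens A B (ZR b) \<longleftrightarrow> b \<in> Ob B"
| "tensor_gens A B (ZRi b) \<longleftrightarrow> b \<in> Ob B"

fun tensor_dom :: "('a, 'f) pcat \<Rightarrow> ('b, 'g) pcat \<Rightarrow> ('a, 'f, 'b, 'g) tgen \<Rightarrow> ('a \<times> 'b) list" where
  "tensor_dom A B (Ten f g) = [(Dom A f, Dom B g)]"
| "tensor_dom A B (DL a b b') = [(a, b), (a, b')]"
| "tensor_dom A B (DLi a b b') = [(a, Plus B b b')]"
| "tensor_dom A B (DR b a a') = [(a, b), (a', b)]"
| "tensor_dom A B (DRi b a a') = [(Plus A a a', b)]"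
| "tensor_dom A B (ZL a) = []"
| "tensor_dom A B (ZLi a) = [(a, Zero B)]"
| "tensor_dom A B (ZR b) = []"
| "tensor_dom A B (ZRi b) = [(Zero A, b)]"

fun tensor_cod :: "('a, 'f) pcat \<Rightarrow> ('b, 'g) pcat \<Rightarrow> ('a, 'f, 'b, 'g) tgen \<Rightarrow> ('a \<times> 'b) list" where
  "tensor_cod A B (Ten f g) = [(Cod A f, Cod B g)]"
| "tensor_cod A B (DL a b b') = [(a, Plus B b b')]"
| "tensor_cod A B (DLi a b b') = [(a, b), (a, b')]"
| "tensor_cod A B (DR b a a') = [(Plus A a a', b)]"
| "tensor_cod A B (DRi b a a') = [(a, b), (a', b)]"
| "tensor_cod A B (ZL a) = [(a, Zero B)]"
| "tensor_cod A B (ZLi a) = []"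
| "tensor_cod A B (ZR b) = [(Zero A, b)]"
| "tensor_cod A B (ZRi b) = []"

inductive tensor_rels :: "('a, 'f) pcat \<Rightarrow> ('b, 'g) pcat \<Rightarrow>
    ('a \<times> 'b, ('a, 'f, 'b, 'g) tgen) pterm \<Rightarrow> ('a \<times> 'b, ('a, 'f, 'b, 'g) tgen) pterm \<Rightarrow> bool"
  for A :: "('a, 'f) pcat" and B :: "('b, 'g) pcat" where
  \<comment> \<open>composition and identities of \<open>A \<times> B\<close>\<close>
  ten_cmp: "\<lbrakk>f \<in> Mor A; f' \<in> Mor A; g \<in> Mor B; g' \<in> Mor B; Dom A f' = Cod A f; Dom B g' = Cod B g\<rbrakk>
    \<Longrightarrow> tensor_rels A B (GenT (Ten (Cmp A f' f) (Cmp B g' g))) (CmpT (GenT (Ten f' g')) (GenT (Ten f g)))"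
| ten_id: "\<lbrakk>a \<in> Ob A; b \<in> Ob B\<rbrakk>
    \<Longrightarrow> tensor_rels A B (GenT (Ten (Idm A a) (Idm B b))) (IdT [(a, b)])"
  \<comment> \<open>the structure morphisms are invertible\<close>
| dl_inv1: "\<lbrakk>a \<in> Ob A; b \<in> Ob B; b' \<in> Ob B\<rbrakk>
    \<Longrightarrow> tensor_rels A B (CmpT (GenT (DLi a b b')) (GenT (DL a b b'))) (IdT [(a, b), (a, b')])"
| dl_inv2: "\<lbrakk>a \<in> Ob A; b \<in> Ob B; b' \<in> Ob B\<rbrakk>
    \<Longrightarrow> tensor_rels A B (CmpT (GenT (DL a b b')) (GenT (DLi a b b'))) (IdT [(a, Plus B b b')])"
| dr_inv1: "\<lbrakk>b \<in> Ob B; a \<in> Ob A; a' \<in> Ob A\<rbrakk>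
    \<Longrightarrow> tensor_rels A B (CmpT (GenT (DRi b a a')) (GenT (DR b a a'))) (IdT [(a, b), (a', b)])"
| dr_inv2: "\<lbrakk>b \<in> Ob B; a \<in> Ob A; a' \<in> Ob A\<rbrakk>
    \<Longrightarrow> tensor_rels A B (CmpT (GenT (DR b a a')) (GenT (DRi b a a'))) (IdT [(Plus A a a', b)])"
| zl_inv1: "a \<in> Ob A \<Longrightarrow> tensor_rels A B (CmpT (GenT (ZLi a)) (GenT (ZL a))) (IdT [])"
| zl_inv2: "a \<in> Ob A \<Longrightarrow> tensor_rels A B (CmpT (GenT (ZL a)) (GenT (ZLi a))) (IdT [(a, Zero B)])"
| zr_inv1: "b \<in> Ob B \<Longrightarrow> tensor_rels A B (CmpT (GenT (ZRi b)) (GenT (ZR b))) (IdT [])"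
| zr_inv2: "b \<in> Ob B \<Longrightarrow> tensor_rels A B (CmpT (GenT (ZR b)) (GenT (ZRi b))) (IdT [(Zero A, b)])"
  \<comment> \<open>naturality of \<open>\<delta>\<^sup>L\<close>, \<open>\<delta>\<^sup>R\<close>, \<open>\<zeta>\<^sup>L\<close>, \<open>\<zeta>\<^sup>R\<close> (that of \<open>\<beta>\<close> is part of \<open>teq\<close>)\<close>
| dl_nat: "\<lbrakk>f \<in> Mor A; g \<in> Mor B; g' \<in> Mor B\<rbrakk>
    \<Longrightarrow> tensor_rels A B
      (CmpT (GenT (Ten f (PlusM B g g'))) (GenT (DL (Dom A f) (Dom B g) (Dom B g'))))
      (CmpT (GenT (DL (Cod A f) (Cod B g) (Cod B g'))) (SumT (GenT (Ten f g)) (GenT (Ten f g'))))"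
| dr_nat: "\<lbrakk>g \<in> Mor B; f \<in> Mor A; f' \<in> Mor A\<rbrakk>
    \<Longrightarrow> tensor_rels A B
      (CmpT (GenT (Ten (PlusM A f f') g)) (GenT (DR (Dom B g) (Dom A f) (Dom A f'))))
      (CmpT (GenT (DR (Cod B g) (Cod A f) (Cod A f'))) (SumT (GenT (Ten f g)) (GenT (Ten f' g))))"
| zl_nat: "f \<in> Mor A
    \<Longrightarrow> tensor_rels A B (CmpT (GenT (Ten f (Idm B (Zero B)))) (GenT (ZL (Dom A f)))) (GenT (ZL (Cod A f)))"
| zr_nat: "g \<in> Mor B
    \<Longrightarrow> tensor_rels A B (CmpT (GenT (Ten (Idm A (Zero A)) g)) (GenT (ZR (Dom B g)))) (GenT (ZR (Cod B g)))"
  \<comment> \<open>\<open>a.(-)\<close> is a symmetric monoidal functor\<close>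
| dl_assoc: "\<lbrakk>a \<in> Ob A; b \<in> Ob B; b' \<in> Ob B; b'' \<in> Ob B\<rbrakk>
    \<Longrightarrow> tensor_rels A B
      (CmpT (GenT (DL a (Plus B b b') b'')) (SumT (GenT (DL a b b')) (IdT [(a, b'')])))
      (CmpT (GenT (DL a b (Plus B b' b''))) (SumT (IdT [(a, b)]) (GenT (DL a b' b''))))"
| dl_unit_left: "\<lbrakk>a \<in> Ob A; b \<in> Ob B\<rbrakk>
    \<Longrightarrow> tensor_rels A B (CmpT (GenT (DL a (Zero B) b)) (SumT (GenT (ZL a)) (IdT [(a, b)]))) (IdT [(a, b)])"
| dl_unit_right: "\<lbrakk>a \<in> Ob A; b \<in> Ob B\<rbrakk>
    \<Longrightarrow> tensor_rels A B (CmpT (GenT (DL a b (Zero B))) (SumT (IdT [(a, b)]) (GenT (ZL a)))) (IdT [(a, b)])"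
| dl_sym: "\<lbrakk>a \<in> Ob A; b \<in> Ob B; b' \<in> Ob B\<rbrakk>
    \<Longrightarrow> tensor_rels A B
      (CmpT (GenT (Ten (Idm A a) (Beta B b b'))) (GenT (DL a b b')))
      (CmpT (GenT (DL a b' b)) (SymT [(a, b)] [(a, b')]))"
  \<comment> \<open>\<open>(-).b\<close> is a symmetric monoidal functor\<close>
| dr_assoc: "\<lbrakk>b \<in> Ob B; a \<in> Ob A; a' \<in> Ob A; a'' \<in> Ob A\<rbrakk>
    \<Longrightarrow> tensor_rels A B
      (CmpT (GenT (DR b (Plus A a a') a'')) (SumT (GenT (DR b a a')) (IdT [(a'', b)])))
      (CmpT (GenT (DR b a (Plus A a' a''))) (SumT (IdT [(a, b)]) (GenT (DR b a' a''))))"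
| dr_unit_left: "\<lbrakk>b \<in> Ob B; a \<in> Ob A\<rbrakk>
    \<Longrightarrow> tensor_rels A B (CmpT (GenT (DR b (Zero A) a)) (SumT (GenT (ZR b)) (IdT [(a, b)]))) (IdT [(a, b)])"
| dr_unit_right: "\<lbrakk>b \<in> Ob B; a \<in> Ob A\<rbrakk>
    \<Longrightarrow> tensor_rels A B (CmpT (GenT (DR b a (Zero A))) (SumT (IdT [(a, b)]) (GenT (ZR b)))) (IdT [(a, b)])"
| dr_sym: "\<lbrakk>b \<in> Ob B; a \<in> Ob A; a' \<in> Ob A\<rbrakk>
    \<Longrightarrow> tensor_rels A B
      (CmpT (GenT (Ten (Beta A a a') (Idm B b))) (GenT (DR b a a')))
      (CmpT (GenT (DR b a' a)) (SymT [(a, b)] [(a', b)]))"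
  \<comment> \<open>compatibility of the two sides\<close>
| dl_dr: "\<lbrakk>a \<in> Ob A; a' \<in> Ob A; b \<in> Ob B; b' \<in> Ob B\<rbrakk>
    \<Longrightarrow> tensor_rels A B
      (CmpT (GenT (DL (Plus A a a') b b')) (SumT (GenT (DR b a a')) (GenT (DR b' a a'))))
      (CmpT (GenT (DR (Plus B b b') a a'))
        (CmpT (SumT (GenT (DL a b b')) (GenT (DL a' b b')))
          (SumT (IdT [(a, b)]) (SumT (SymT [(a', b)] [(a, b')]) (IdT [(a', b')])))))"
| zl_zr: "tensor_rels A B (GenT (ZL (Zero A))) (GenT (ZR (Zero B)))"
| dr_zl: "\<lbrakk>a \<in> Ob A; a' \<in> Ob A\<rbrakk>
    \<Longrightarrow> tensor_rels A B
      (CmpT (GenT (DR (Zero B) a a')) (SumT (GenT (ZL a)) (GenT (ZL a')))) (GenT (ZL (Plus A a a')))"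
| dl_zr: "\<lbrakk>b \<in> Ob B; b' \<in> Ob B\<rbrakk>
    \<Longrightarrow> tensor_rels A B
      (CmpT (GenT (DL (Zero A) b b')) (SumT (GenT (ZR b)) (GenT (ZR b')))) (GenT (ZR (Plus B b b')))"

definition tensor_pres ::
  "('a, 'f) pcat \<Rightarrow> ('b, 'g) pcat \<Rightarrow> ('a \<times> 'b, ('a, 'f, 'b, 'g) tgen) presentation" where
  "tensor_pres A B = \<lparr>Atoms = Ob A \<times> Ob B, Gens = Collect (tensor_gens A B),
     gdom = tensor_dom A B, gcod = tensor_cod A B, Rels = tensor_rels A B\<rparr>"

definition tensor :: "('a, 'f) pcat \<Rightarrow> ('b, 'g) pcat \<Rightarrow>
    (('a \<times> 'b) list, ('a \<times> 'b, ('a, 'f, 'b, 'g) tgen) pterm set) pcat" (infixr "\<otimes>\<^sub>P" 70) where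
  "A \<otimes>\<^sub>P B = presented (tensor_pres A B)"

text \<open>\<open>F \<otimes> G\<close> for strict \<open>F\<close>, \<open>G\<close>: the constraints \<open>F\<^sub>2\<close>, \<open>F\<^sub>0\<close>, \<open>G\<^sub>2\<close>, \<open>G\<^sub>0\<close> being identities,
  \<open>\<delta>\<^sup>L\<^sub>a\<close> goes to \<open>\<delta>\<^sup>L\<^bsub>Fa\<^esub>\<close>, and so on. \<open>A\<close> and \<open>B\<close> are the codomains of \<open>F\<close> and \<open>G\<close>.\<close>

definition tensor_func :: "('a, 'f) pcat \<Rightarrow> ('b, 'g) pcat \<Rightarrow>
    ('c, 'h, 'a, 'f) func \<Rightarrow> ('d, 'k, 'b, 'g) func \<Rightarrow>
    (('c \<times> 'd) list, ('c \<times> 'd, ('c, 'h, 'd, 'k) tgen) pterm set,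
     ('a \<times> 'b) list, ('a \<times> 'b, ('a, 'f, 'b, 'g) tgen) pterm set) func" where
  "tensor_func A B F G = extend (A \<otimes>\<^sub>P B) (\<lambda>(x, y). [(Fo F x, Fo G y)])
     (\<lambda>g. cls (tensor_pres A B) (GenT (map_tgen (Fo F) (Fm F) (Fo G) (Fm G) g)))"


section \<open>The functor \<open>\<Phi>\<close> from \<open>PX \<otimes> PY\<close> to \<open>P(X \<times> Y)\<close>\<close>

text \<open>The effect of \<open>\<Phi>\<close> on \<open>f.1\<close> with \<open>1\<close> the identity of \<open>\<Sum>\<^sub>j y\<^sub>j\<close>: it sends \<open>\<Sum>\<^sub>i f\<^sub>i\<close> to
  \<open>\<Sum>\<^sub>i\<Sum>\<^sub>j (f\<^sub>i, 1)\<close> and symmetries to symmetries.\<close>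

definition Phi_left :: "('o, 'm) cat \<Rightarrow> ('p, 'n) cat \<Rightarrow> ('o, 'm) pterm set \<Rightarrow> 'p list \<Rightarrow>
    ('o \<times> 'p, 'm \<times> 'n) pterm set" where
  "Phi_left X Y f ys = Fm (extend (FreeP (prod_cat X Y)) (\<lambda>x. map (Pair x) ys)
     (\<lambda>h. sumM (FreeP (prod_cat X Y)) (map (\<lambda>y. incl (prod_cat X Y) (h, Idm Y y)) ys))) f"

text \<open>The effect of \<open>\<Phi>\<close> on \<open>1.g\<close> with \<open>1\<close> the identity of \<open>\<Sum>\<^sub>i x\<^sub>i\<close>: the sum over \<open>i\<close> of the
  morphisms that arise from \<open>g\<close> by sending \<open>\<Sum>\<^sub>j g\<^sub>j\<close> to \<open>\<Sum>\<^sub>j (1, g\<^sub>j)\<close> and symmetries to symmetries.\<close>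

definition Phi_right :: "('o, 'm) cat \<Rightarrow> ('p, 'n) cat \<Rightarrow> 'o list \<Rightarrow> ('p, 'n) pterm set \<Rightarrow>
    ('o \<times> 'p, 'm \<times> 'n) pterm set" where
  "Phi_right X Y xs g = sumM (FreeP (prod_cat X Y))
     (map (\<lambda>x. Fm (extend (FreeP (prod_cat X Y)) (\<lambda>y. [(x, y)])
        (\<lambda>h. incl (prod_cat X Y) (Idm X x, h))) g) xs)"

text \<open>The symmetry
  \<open>\<Sum>\<^sub>i\<Sum>\<^sub>j (x\<^sub>i, y\<^sub>j) + \<Sum>\<^sub>i\<Sum>\<^sub>k (x\<^sub>i, y'\<^sub>k) \<rightarrow> \<Sum>\<^sub>i (\<Sum>\<^sub>j (x\<^sub>i, y\<^sub>j) + \<Sum>\<^sub>k (x\<^sub>i, y'\<^sub>k))\<close>,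
  which moves the block \<open>\<Sum>\<^sub>k (x\<^sub>1, y'\<^sub>k)\<close> to the second place and continues with the remaining \<open>x\<^sub>i\<close>.\<close>

fun Phi_delta :: "('o, 'm) cat \<Rightarrow> ('p, 'n) cat \<Rightarrow> 'o list \<Rightarrow> 'p list \<Rightarrow> 'p list \<Rightarrow>
    ('o \<times> 'p, 'm \<times> 'n) pterm set" where
  "Phi_delta X Y [] ys ys' = Idm (FreeP (prod_cat X Y)) []"
| "Phi_delta X Y (x # xs) ys ys' = (let D = FreeP (prod_cat X Y) in
     Cmp D
       (PlusM D (Idm D (map (Pair x) (ys @ ys'))) (Phi_delta X Y xs ys ys'))
       (PlusM D (Idm D (map (Pair x) ys))
         (PlusM D (Beta D (List.product xs ys) (map (Pair x) ys'))
           (Idm D (List.product xs ys')))))"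

text \<open>By functoriality, \<open>f.g\<close> is sent to the composite of the images of \<open>f.1\<close> and \<open>1.g\<close>. The value
  on \<open>\<delta>\<^sup>R\<close>, \<open>\<zeta>\<^sup>L\<close>, \<open>\<zeta>\<^sup>R\<close> is the identity of their common source and target after applying \<open>\<Phi>\<close>.\<close>

fun Phi_gen :: "('o, 'm) cat \<Rightarrow> ('p, 'n) cat \<Rightarrow>
    ('o list, ('o, 'm) pterm set, 'p list, ('p, 'n) pterm set) tgen \<Rightarrow>
    ('o \<times> 'p, 'm \<times> 'n) pterm set" where
  "Phi_gen X Y (Ten f g) = Cmp (FreeP (prod_cat X Y))
     (Phi_left X Y f (Cod (FreeP Y) g)) (Phi_right X Y (Dom (FreeP X) f) g)"
| "Phi_gen X Y (DL xs ys ys') = Phi_delta X Y xs ys ys'"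
| "Phi_gen X Y (DLi xs ys ys') = inverse_mor (FreeP (prod_cat X Y)) (Phi_delta X Y xs ys ys')"
| "Phi_gen X Y (DR ys xs xs') = Idm (FreeP (prod_cat X Y)) (List.product (xs @ xs') ys)"
| "Phi_gen X Y (DRi ys xs xs') = Idm (FreeP (prod_cat X Y)) (List.product (xs @ xs') ys)"
| "Phi_gen X Y (ZL xs) = Idm (FreeP (prod_cat X Y)) []"
| "Phi_gen X Y (ZLi xs) = Idm (FreeP (prod_cat X Y)) []"
| "Phi_gen X Y (ZR ys) = Idm (FreeP (prod_cat X Y)) []"
| "Phi_gen X Y (ZRi ys) = Idm (FreeP (prod_cat X Y)) []"

definition Phi :: "('o, 'm) cat \<Rightarrow> ('p, 'n) cat \<Rightarrow>
    (('o list \<times> 'p list) list,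
     ('o list \<times> 'p list, ('o list, ('o, 'm) pterm set, 'p list, ('p, 'n) pterm set) tgen) pterm set,
     ('o \<times> 'p) list, ('o \<times> 'p, 'm \<times> 'n) pterm set) func" where
  "Phi X Y = extend (FreeP (prod_cat X Y)) (\<lambda>(xs, ys). List.product xs ys) (Phi_gen X Y)"


section \<open>Iterated tensors\<close>

text \<open>The length-1 constituents of an iterated tensor share the types \<open>'o\<close>, \<open>'m\<close>, but are arbitrary
  permutative categories on subsets of them.\<close>

datatype ('o, 'm) itensor =
    Leaf "('o, 'm) pcat"
  | Node "('o, 'm) itensor" "('o, 'm) itensor"

fun iterated_tensor :: "nat \<Rightarrow> ('o, 'm) itensor \<Rightarrow> bool" where
  "iterated_tensor k (Leaf A) \<longleftrightarrow> k = 1 \<and> permutative A"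
| "iterated_tensor k (Node L R) \<longleftrightarrow> (\<exists>i j. i + j = k \<and> iterated_tensor i L \<and> iterated_tensor j R)"

text \<open>Since the type of \<open>A \<otimes> B\<close> differs from those of \<open>A\<close> and \<open>B\<close>, the underlying object
  of an iterated tensor is formed on recursive types of objects and of morphism names, by relabelling
  \<open>A \<otimes> B\<close> at each stage. The name of a morphism of \<open>A \<otimes> B\<close>, an equivalence class of
  terms, is a chosen member of the class.\<close>

datatype 'o tob = LeafOb 'o | NodeOb "('o tob \<times> 'o tob) list"

datatype ('o, 'm) tmor =
    LeafMor 'm
  | NodeMor "('o tob \<times> 'o tob, ('o tob, ('o, 'm) tmor, 'o tob, ('o, 'm) tmor) tgen) pterm"

definition node_name ::
  "('o tob \<times> 'o tob, ('o tob, ('o, 'm) tmor, 'o tob, ('o, 'm) tmor) tgen) pterm set \<Rightarrow> ('o, 'm) tmor" where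
  "node_name c = NodeMor (rep c)"

fun underlying :: "('o, 'm) itensor \<Rightarrow> ('o tob, ('o, 'm) tmor) pcat" where
  "underlying (Leaf A) = relabel LeafOb LeafMor A"
| "underlying (Node L R) = relabel NodeOb node_name (underlying L \<otimes>\<^sub>P underlying R)"

fun Pob :: "('o, 'm) itensor \<Rightarrow> ('o list, ('o, 'o) pterm set) itensor" where
  "Pob (Leaf A) = Leaf (FreeP (discrete (Ob A)))"
| "Pob (Node L R) = Node (Pob L) (Pob R)"

text \<open>The set \<open>T\<close>, regarded as a discrete category; \<open>TPair\<close> is the pairing that identifies
  the product \<open>T L \<times> T R\<close> with \<open>T (Node L R)\<close>.\<close>

datatype 'o tidx = TLeaf 'o | TPair "'o tidx" "'o tidx"

fun Tset :: "('o, 'm) itensor \<Rightarrow> 'o tidx set" where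
  "Tset (Leaf A) = TLeaf ` Ob A"
| "Tset (Node L R) = (\<lambda>(x, y). TPair x y) ` (Tset L \<times> Tset R)"

definition T :: "('o, 'm) itensor \<Rightarrow> ('o tidx, 'o tidx) cat" where
  "T Q = discrete (Tset Q)"

text \<open>\<open>\<chi> : (P ob)(Q) \<rightarrow> Q\<close> and \<open>\<Phi> : (P ob)(Q) \<rightarrow> P T(Q)\<close>, up to the relabellings.\<close>

fun chi :: "('o, 'm) itensor \<Rightarrow>
    ('o list tob, ('o list, ('o, 'o) pterm set) tmor, 'o tob, ('o, 'm) tmor) func" where
  "chi (Leaf A) = to_relabel LeafOb LeafMor \<circ>\<^sub>F extend A (\<lambda>x. x) (Idm A)
     \<circ>\<^sub>F from_relabel LeafOb LeafMor (FreeP (discrete (Ob A)))"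
| "chi (Node L R) = to_relabel NodeOb node_name
     \<circ>\<^sub>F tensor_func (underlying L) (underlying R) (chi L) (chi R)
     \<circ>\<^sub>F from_relabel NodeOb node_name (underlying (Pob L) \<otimes>\<^sub>P underlying (Pob R))"

fun Phi_iter :: "('o, 'm) itensor \<Rightarrow>
    ('o list tob, ('o list, ('o, 'o) pterm set) tmor,
     'o tidx list, ('o tidx, 'o tidx) pterm set) func" where
  "Phi_iter (Leaf A) = FreeP_map (T (Leaf A)) TLeaf TLeaf
     \<circ>\<^sub>F from_relabel LeafOb LeafMor (FreeP (discrete (Ob A)))"
| "Phi_iter (Node L R) = FreeP_map (T (Node L R)) (\<lambda>(x, y). TPair x y) (\<lambda>(x, y). TPair x y)
     \<circ>\<^sub>F Phi (T L) (T R)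
     \<circ>\<^sub>F tensor_func (FreeP (T L)) (FreeP (T R)) (Phi_iter L) (Phi_iter R)
     \<circ>\<^sub>F from_relabel NodeOb node_name (underlying (Pob L) \<otimes>\<^sub>P underlying (Pob R))"


section \<open>Formal pairs of morphisms\<close>

text \<open>A lift of the 2-arrow diagram \<open>\<kappa>\<close>, \<open>\<kappa>'\<close> along \<open>\<chi>\<close>: a pair of parallel lifts.\<close>

definition lift_pair :: "('o, 'm) itensor \<Rightarrow> ('o, 'm) tmor \<Rightarrow> ('o, 'm) tmor \<Rightarrow>
    ('o list, ('o, 'o) pterm set) tmor \<Rightarrow> ('o list, ('o, 'o) pterm set) tmor \<Rightarrow> bool" where
  "lift_pair Q \<kappa> \<kappa>' l l' \<longleftrightarrow>
     parallel (underlying (Pob Q)) l l' \<and> Fm (chi Q) l = \<kappa> \<and> Fm (chi Q) l' = \<kappa>'"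

definition formal_pair :: "('o, 'm) itensor \<Rightarrow> ('o, 'm) tmor \<Rightarrow> ('o, 'm) tmor \<Rightarrow> bool" where
  "formal_pair Q \<kappa> \<kappa>' \<longleftrightarrow> (\<exists>l l'. lift_pair Q \<kappa> \<kappa>' l l')"

text \<open>The coinciding permutations are those of the two members of one lift of the 2-arrow diagram.
  For unrelated lifts of \<open>\<kappa>\<close> and \<open>\<kappa>'\<close> the hypothesis would be weaker and would not imply \<open>\<kappa> = \<kappa>'\<close>:
  let \<open>A\<close> have objects \<open>\<int>/2\<close>, automorphism groups \<open>{1,-1}\<close> and \<open>\<beta>\<^bsub>1,1\<^esub> = -1\<close>. Over \<open>A \<otimes> A\<close>, the words
  \<open>(1+1).1 + 1.0\<close> and \<open>0.1 + 1.(1+1)\<close> have the same value \<open>q\<close> under \<open>\<chi>\<close> and the same value under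
  \<open>\<Phi>\<close>, but the isomorphism \<open>s\<close> between them with \<open>\<Phi>(s) = 1\<close> goes to an automorphism of \<open>q\<close> of
  order 4. So \<open>\<chi>(s + s) \<noteq> 1\<close>, although \<open>\<Phi>(s + s) = 1\<close>; and \<open>\<chi>(s + s)\<close>, \<open>1\<close> is a formal pair,
  since \<open>\<chi>(s + s)\<close> is also the image of \<open>\<beta>.1 + 1\<close> with \<open>\<beta> : 1+1 \<rightarrow> 1+1\<close>.\<close>

definition same_underlying_permutation ::
  "('o, 'm) itensor \<Rightarrow> ('o, 'm) tmor \<Rightarrow> ('o, 'm) tmor \<Rightarrow> bool" where
  "same_underlying_permutation Q \<kappa> \<kappa>' \<longleftrightarrow>
     (\<exists>l l'. lift_pair Q \<kappa> \<kappa>' l l' \<and> Fm (Phi_iter Q) l = Fm (Phi_iter Q) l')"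

end

(*
  The iterated functor Phi is faithful, so parallel lifts with the same underlying permutation are
  already equal, and so are their images under chi.  Faithfulness follows from a strict symmetric monoidal
  functor G in the other direction and a monoidal natural family of split epimorphisms
  theta_x : G F x -> x, since then f theta = theta G(F f) determines f.  Such data compose, and they
  tensor because theta_a.theta'_b is again natural and monoidal.  For Phi : PX (x) PY -> P(X x Y), G
  sends (x,y) to x.y and theta is the canonical morphism sum_i sum_j x_i.y_j -> (sum_i x_i).(sum_j y_j)
  built from the distributivity constraints.  Naturality of theta is checked on terms, so only the
  values of Phi on generators matter, not whether Phi respects the relations.
*)
theory Submission
  imports Defs
begin

section \<open>Permutative categories and strict functors\<close>

text \<open>\<open>extend\<close> evaluates one chosen representative of each class, so it gives a
  function on morphisms even when nothing is known about the relations. This is why the forward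
  direction may be a mere \<open>graph_map\<close>: that \<open>Phi\<close> respects the relations,
  above all \<open>dl_dr\<close>, would be a coherence proof about permutations in its own right.
  Only the backward functors have to be well defined. Apart from relabellings they start either from
  a free permutative category, whose given relations are just composition and identities, or are
  tensor products of such functors, where each relation goes to the relation of the same name. The
  coherence content sits in the naturality of \<open>\<theta>\<close> on the generators of
  \<open>PX \<otimes>\<^sub>P PY\<close>. \<open>List.product\<close> lists pairs row by row, so
  \<open>DR\<close> amounts to concatenation and goes to an identity, while \<open>DL\<close> must
  permute blocks; the relation \<open>dl_dr\<close> between the two is what produces that
  permutation.\<close>

context permutative
begin

lemma cmp_idL: "\<lbrakk>f \<in> Mor C; Cod C f = x\<rbrakk> \<Longrightarrow> Cmp C (Idm C x) f = f"
  using cmp_id_left by blast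

lemma cmp_idR: "\<lbrakk>f \<in> Mor C; Dom C f = x\<rbrakk> \<Longrightarrow> Cmp C f (Idm C x) = f"
  using cmp_id_right by blast

lemmas typing [simp] = dom_ob cod_ob id_mor id_dom id_cod cmp_mor cmp_dom cmp_cod cmp_idL cmp_idR
  zero_ob plus_ob plus_mor plus_dom plus_cod plus_id zero_plus plus_zero zero_plusM plusM_zero
  beta_mor beta_dom beta_cod

lemma beta_natural:
  "\<lbrakk>f \<in> Mor C; g \<in> Mor C; Dom C f = x; Dom C g = y; Cod C f = x'; Cod C g = y'\<rbrakk>
    \<Longrightarrow> Cmp C (Beta C x' y') (PlusM C f g) = Cmp C (PlusM C g f) (Beta C x y)"
  using beta_nat by blast

text \<open>Split rather than plain epimorphisms: sections are carried along by strict functors and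
  sums, and a pair of sections gives a section in a tensor product. Right cancellation alone would
  not be preserved.\<close>

definition split_epi :: "'m \<Rightarrow> bool" where
  "split_epi f \<longleftrightarrow> f \<in> Mor C \<and>
     (\<exists>t\<in>Mor C. Dom C t = Cod C f \<and> Cod C t = Dom C f \<and> Cmp C f t = Idm C (Cod C f))"

lemma split_epiI:
  "\<lbrakk>f \<in> Mor C; t \<in> Mor C; Dom C t = Cod C f; Cod C t = Dom C f; Cmp C f t = Idm C (Cod C f)\<rbrakk>
    \<Longrightarrow> split_epi f"
  unfolding split_epi_def by blast

lemma split_epi_mor: "split_epi f \<Longrightarrow> f \<in> Mor C"
  unfolding split_epi_def by blast

lemma split_epi_id: "x \<in> Ob C \<Longrightarrow> split_epi (Idm C x)"
  by (rule split_epiI[where t = "Idm C x"]) auto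

lemma split_epi_cmp:
  assumes "split_epi f" "split_epi g" "Dom C g = Cod C f"
  shows "split_epi (Cmp C g f)"
proof -
  obtain s t where s: "s \<in> Mor C" "Dom C s = Cod C f" "Cod C s = Dom C f" "Cmp C f s = Idm C (Cod C f)"
    and t: "t \<in> Mor C" "Dom C t = Cod C g" "Cod C t = Dom C g" "Cmp C g t = Idm C (Cod C g)"
    and f: "f \<in> Mor C" and g: "g \<in> Mor C"
    using assms unfolding split_epi_def by blast
  have "Cmp C (Cmp C g f) (Cmp C s t) = Cmp C g (Cmp C f (Cmp C s t))"
    using s t f g assms(3) by (intro cmp_assoc[symmetric]) auto
  also have "Cmp C f (Cmp C s t) = Cmp C (Cmp C f s) t"
    using s t f g assms(3) by (intro cmp_assoc) auto
  finally show ?thesis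
    using s t f g assms(3) by (intro split_epiI[where t = "Cmp C s t"]) auto
qed

lemma split_epi_plus:
  assumes "split_epi f" "split_epi g"
  shows "split_epi (PlusM C f g)"
proof -
  obtain s t where s: "s \<in> Mor C" "Dom C s = Cod C f" "Cod C s = Dom C f" "Cmp C f s = Idm C (Cod C f)"
    and t: "t \<in> Mor C" "Dom C t = Cod C g" "Cod C t = Dom C g" "Cmp C g t = Idm C (Cod C g)"
    and f: "f \<in> Mor C" and g: "g \<in> Mor C"
    using assms unfolding split_epi_def by blast
  have "Cmp C (PlusM C f g) (PlusM C s t) = Idm C (Plus C (Cod C f) (Cod C g))"
    using s t f g by (subst plus_cmp[symmetric]) auto
  then show ?thesis
    using s t f g by (intro split_epiI[where t = "PlusM C s t"]) auto
qed

lemma split_epi_cancel: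
  assumes "split_epi e" "f \<in> Mor C" "g \<in> Mor C" "Dom C f = Cod C e" "Dom C g = Cod C e"
    and "Cmp C f e = Cmp C g e"
  shows "f = g"
proof -
  obtain t where t: "t \<in> Mor C" "Dom C t = Cod C e" "Cod C t = Dom C e" "Cmp C e t = Idm C (Cod C e)"
    and e: "e \<in> Mor C"
    using assms(1) unfolding split_epi_def by blast
  have "Cmp C f (Cmp C e t) = Cmp C g (Cmp C e t)"
    using assms(2-6) t(1,2,3) e by (simp add: cmp_assoc)
  then show ?thesis using assms t by simp
qed

text \<open>The inverse is a separate argument because the tensor product names it as a generator
  (\<open>DLi\<close>, \<open>DRi\<close>, \<open>ZLi\<close>, \<open>ZRi\<close>).
  \<open>inverse_mor_eq\<close> links it to the definite description that \<open>Phi_gen\<close>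
  uses on \<open>DLi\<close>.\<close>

definition inverse_pair :: "'m \<Rightarrow> 'm \<Rightarrow> bool" where
  "inverse_pair f g \<longleftrightarrow> f \<in> Mor C \<and> g \<in> Mor C \<and> Dom C g = Cod C f \<and> Cod C g = Dom C f
     \<and> Cmp C g f = Idm C (Dom C f) \<and> Cmp C f g = Idm C (Cod C f)"

lemma inverse_pair_epi: "inverse_pair f g \<Longrightarrow> split_epi f"
  unfolding inverse_pair_def split_epi_def by blast

lemma inverse_pair_unique:
  assumes "inverse_pair f g" "inverse_pair f h"
  shows "g = h"
proof -
  have "Cmp C g (Cmp C f h) = Cmp C (Cmp C g f) h"
    using assms unfolding inverse_pair_def by (intro cmp_assoc) auto
  then show ?thesis using assms unfolding inverse_pair_def by simp
qed

lemma inverse_mor_eq: "inverse_pair f g \<Longrightarrow> inverse_mor C f = g"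
  unfolding inverse_mor_def
  by (rule the_equality) (auto simp: inverse_pair_def intro: inverse_pair_unique[of f])

lemma inverse_pair_id: "x \<in> Ob C \<Longrightarrow> inverse_pair (Idm C x) (Idm C x)"
  unfolding inverse_pair_def by auto

lemma inverse_pair_beta: "\<lbrakk>x \<in> Ob C; y \<in> Ob C\<rbrakk> \<Longrightarrow> inverse_pair (Beta C x y) (Beta C y x)"
  unfolding inverse_pair_def by (auto simp: beta_inv)

lemma inverse_pair_plus:
  "\<lbrakk>inverse_pair f f'; inverse_pair g g'\<rbrakk> \<Longrightarrow> inverse_pair (PlusM C f g) (PlusM C f' g')"
  unfolding inverse_pair_def by (auto simp: plus_cmp[symmetric])

lemma inverse_pair_cmp:
  assumes "inverse_pair f f'" "inverse_pair g g'" "Dom C g = Cod C f"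
  shows "inverse_pair (Cmp C g f) (Cmp C f' g')"
proof -
  note a = assms[unfolded inverse_pair_def]
  have "Cmp C (Cmp C f' g') (Cmp C g f) = Cmp C f' (Cmp C g' (Cmp C g f))"
    using a by (intro cmp_assoc[symmetric]) auto
  also have "Cmp C g' (Cmp C g f) = f"
    using a by (subst cmp_assoc) auto
  finally have 1: "Cmp C (Cmp C f' g') (Cmp C g f) = Idm C (Dom C f)" using a by simp
  have "Cmp C (Cmp C g f) (Cmp C f' g') = Cmp C g (Cmp C f (Cmp C f' g'))"
    using a by (intro cmp_assoc[symmetric]) auto
  also have "Cmp C f (Cmp C f' g') = g'"
    using a by (subst cmp_assoc) auto
  finally have 2: "Cmp C (Cmp C g f) (Cmp C f' g') = Idm C (Cod C g)" using a by simp
  show ?thesis using a 1 2 unfolding inverse_pair_def by auto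
qed

text \<open>Inserting \<open>e\<close> after \<open>e'\<close> and cancelling \<open>d\<close>
  against \<open>d'\<close> turns a naturality square of an invertible constraint into the square of
  its inverse. Naturality at formal inverses is obtained this way.\<close>

lemma inverse_pair_square:
  assumes "inverse_pair d d'" "inverse_pair e e'" "x \<in> Mor C" "y \<in> Mor C"
    and "Cod C x = Dom C d" "Dom C y = Cod C e" "Dom C x = Dom C e" "Cod C y = Cod C d"
    and "Cmp C d x = Cmp C y e"
  shows "Cmp C d' y = Cmp C x e'"
proof -
  note a = assms[unfolded inverse_pair_def]
  have "Cmp C d' y = Cmp C d' (Cmp C y (Cmp C e e'))"
    using a by auto
  also have "Cmp C y (Cmp C e e') = Cmp C (Cmp C y e) e'"
    using a by (intro cmp_assoc) auto
  also have "\<dots> = Cmp C (Cmp C d x) e'" using a by simp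
  also have "\<dots> = Cmp C d (Cmp C x e')"
    using a by (intro cmp_assoc[symmetric]) auto
  also have "Cmp C d' \<dots> = Cmp C (Cmp C d' d) (Cmp C x e')"
    using a by (intro cmp_assoc) auto
  finally show ?thesis using a by auto
qed

end

text \<open>A map of underlying graphs that is strictly monoidal on objects. Functoriality is not
  required: this makes it unnecessary to show that \<open>\<Phi>\<close> respects the relations of the tensor
  product.\<close>

locale graph_map = dom: permutative C + cod: permutative D
  for C :: "('o, 'm) pcat" and D :: "('p, 'n) pcat" +
  fixes F :: "('o, 'm, 'p, 'n) func"
  assumes map_ob [simp]: "x \<in> Ob C \<Longrightarrow> Fo F x \<in> Ob D"
    and map_mor [simp]: "f \<in> Mor C \<Longrightarrow> Fm F f \<in> Mor D"
    and map_dom [simp]: "f \<in> Mor C \<Longrightarrow> Dom D (Fm F f) = Fo F (Dom C f)"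
    and map_cod [simp]: "f \<in> Mor C \<Longrightarrow> Cod D (Fm F f) = Fo F (Cod C f)"
    and map_zero [simp]: "Fo F (Zero C) = Zero D"
    and map_plus [simp]: "\<lbrakk>x \<in> Ob C; y \<in> Ob C\<rbrakk> \<Longrightarrow> Fo F (Plus C x y) = Plus D (Fo F x) (Fo F y)"

locale strict_functor = graph_map +
  assumes map_id [simp]: "x \<in> Ob C \<Longrightarrow> Fm F (Idm C x) = Idm D (Fo F x)"
    and map_cmp [simp]: "\<lbrakk>f \<in> Mor C; g \<in> Mor C; Dom C g = Cod C f\<rbrakk>
      \<Longrightarrow> Fm F (Cmp C g f) = Cmp D (Fm F g) (Fm F f)"
    and map_plusM [simp]: "\<lbrakk>f \<in> Mor C; g \<in> Mor C\<rbrakk>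
      \<Longrightarrow> Fm F (PlusM C f g) = PlusM D (Fm F f) (Fm F g)"
    and map_beta [simp]: "\<lbrakk>x \<in> Ob C; y \<in> Ob C\<rbrakk>
      \<Longrightarrow> Fm F (Beta C x y) = Beta D (Fo F x) (Fo F y)"
begin

lemma map_split_epi:
  assumes "dom.split_epi f"
  shows "cod.split_epi (Fm F f)"
proof -
  obtain t where f: "f \<in> Mor C" and t: "t \<in> Mor C" "Dom C t = Cod C f" "Cod C t = Dom C f"
      "Cmp C f t = Idm C (Cod C f)"
    using assms unfolding dom.split_epi_def by blast
  have "Cmp D (Fm F f) (Fm F t) = Fm F (Cmp C f t)" using f t(1,2,3) by simp
  also have "\<dots> = Idm D (Fo F (Cod C f))" unfolding t(4) using f by simp
  finally show ?thesis using f t by (intro cod.split_epiI[where t = "Fm F t"]) auto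
qed

lemma map_inverse_pair:
  assumes "dom.inverse_pair f g"
  shows "cod.inverse_pair (Fm F f) (Fm F g)"
proof -
  note a = assms[unfolded dom.inverse_pair_def]
  have "Cmp D (Fm F f) (Fm F g) = Fm F (Cmp C f g)" "Cmp D (Fm F g) (Fm F f) = Fm F (Cmp C g f)"
    using a by (metis map_cmp)+
  then show ?thesis using a unfolding cod.inverse_pair_def by simp
qed

end

text \<open>\<open>G\<close> is a genuine strict functor because it has to transport the
  \<open>\<theta>'\<close> of a further stage. The strict equations \<open>th_zero\<close> and
  \<open>th_plus\<close> are what allow the naturality of \<open>DL\<close>, \<open>DR\<close>,
  \<open>ZL\<close>, \<open>ZR\<close> in a tensor product to be applied with components of
  \<open>\<theta>\<close> as the varying morphisms.\<close>

locale left_equivalence = F: graph_map C D F + G: strict_functor D C G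
  for C :: "('o, 'm) pcat" and D :: "('p, 'n) pcat" and F G +
  fixes \<theta> :: "'o \<Rightarrow> 'm"
  assumes epi [simp]: "x \<in> Ob C \<Longrightarrow> F.dom.split_epi (\<theta> x)"
    and th_dom [simp]: "x \<in> Ob C \<Longrightarrow> Dom C (\<theta> x) = Fo G (Fo F x)"
    and th_cod [simp]: "x \<in> Ob C \<Longrightarrow> Cod C (\<theta> x) = x"
    and th_zero [simp]: "\<theta> (Zero C) = Idm C (Zero C)"
    and th_plus [simp]: "\<lbrakk>x \<in> Ob C; y \<in> Ob C\<rbrakk> \<Longrightarrow> \<theta> (Plus C x y) = PlusM C (\<theta> x) (\<theta> y)"
    and natural: "f \<in> Mor C \<Longrightarrow> Cmp C f (\<theta> (Dom C f)) = Cmp C (\<theta> (Cod C f)) (Fm G (Fm F f))"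
begin

lemma th_mor [simp]: "x \<in> Ob C \<Longrightarrow> \<theta> x \<in> Mor C"
  by (rule F.dom.split_epi_mor) simp

lemma faithful:
  assumes "parallel C f g" "Fm F f = Fm F g"
  shows "f = g"
proof (rule F.dom.split_epi_cancel)
  show "F.dom.split_epi (\<theta> (Dom C f))" using assms by (simp add: parallel_def)
  show "Cmp C f (\<theta> (Dom C f)) = Cmp C g (\<theta> (Dom C f))"
    using natural[of f] natural[of g] assms by (simp add: parallel_def)
qed (use assms in \<open>auto simp: parallel_def\<close>)

end

lemma strict_functor_comp:
  assumes "strict_functor C D F" "strict_functor D E G"
  shows "strict_functor C E (G \<circ>\<^sub>F F)"
proof -
  interpret F: strict_functor C D F by fact
  interpret G: strict_functor D E G by fact
  show ?thesis by unfold_locales (simp_all add: comp_func_def)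
qed

text \<open>The square of \<open>\<theta>\<close> at \<open>f\<close> is pasted to the image under
  \<open>G\<close> of the square of \<open>\<theta>'\<close> at \<open>Fm F f\<close>. Strictness of
  \<open>G\<close> preserves the sections and the sums of the components of
  \<open>\<theta>'\<close>.\<close>

lemma left_equivalence_comp:
  assumes "left_equivalence C D F G \<theta>" "left_equivalence D E F' G' \<theta>'"
  shows "left_equivalence C E (F' \<circ>\<^sub>F F) (G \<circ>\<^sub>F G') (\<lambda>x. Cmp C (\<theta> x) (Fm G (\<theta>' (Fo F x))))"
proof -
  interpret A1: left_equivalence C D F G \<theta> by fact
  interpret A2: left_equivalence D E F' G' \<theta>' by fact
  interpret G: strict_functor E C "G \<circ>\<^sub>F G'"
    by (rule strict_functor_comp[OF A2.G.strict_functor_axioms A1.G.strict_functor_axioms])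
  show ?thesis
  proof unfold_locales
    fix f assume f: "f \<in> Mor C"
    let ?h = "Fm F f"
    have "Cmp C f (Cmp C (\<theta> (Dom C f)) (Fm G (\<theta>' (Fo F (Dom C f)))))
        = Cmp C (Cmp C f (\<theta> (Dom C f))) (Fm G (\<theta>' (Fo F (Dom C f))))"
      using f by (intro A1.F.dom.cmp_assoc) auto
    also have "\<dots> = Cmp C (\<theta> (Cod C f)) (Cmp C (Fm G ?h) (Fm G (\<theta>' (Fo F (Dom C f)))))"
      unfolding A1.natural[OF f] using f by (intro A1.F.dom.cmp_assoc[symmetric]) auto
    also have "Cmp C (Fm G ?h) (Fm G (\<theta>' (Fo F (Dom C f)))) = Fm G (Cmp D ?h (\<theta>' (Dom D ?h)))"
      using f by simp
    also have "\<dots> = Cmp C (Fm G (\<theta>' (Fo F (Cod C f)))) (Fm G (Fm G' (Fm F' ?h)))"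
      using f A2.natural[of ?h] by simp
    also have "Cmp C (\<theta> (Cod C f)) \<dots>
        = Cmp C (Cmp C (\<theta> (Cod C f)) (Fm G (\<theta>' (Fo F (Cod C f))))) (Fm G (Fm G' (Fm F' ?h)))"
      using f by (intro A1.F.dom.cmp_assoc) auto
    finally show "Cmp C f (Cmp C (\<theta> (Dom C f)) (Fm G (\<theta>' (Fo F (Dom C f)))))
      = Cmp C (Cmp C (\<theta> (Cod C f)) (Fm G (\<theta>' (Fo F (Cod C f))))) (Fm (G \<circ>\<^sub>F G') (Fm (F' \<circ>\<^sub>F F) f))"
      by (simp add: comp_func_def)
  qed (auto simp: comp_func_def A1.F.dom.plus_cmp
      intro!: A1.F.dom.split_epi_cmp A1.G.map_split_epi)
qed

section \<open>Presented permutative categories\<close>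

lemma sumM_simps: "sumM C [] = Idm C (Zero C)" "sumM C (f # fs) = PlusM C f (sumM C fs)"
  by (simp_all add: sumM_def)

locale well_formed =
  fixes P :: "('x, 'g) presentation"
  assumes gdom_atoms: "g \<in> Gens P \<Longrightarrow> gdom P g \<in> lists (Atoms P)"
    and gcod_atoms: "g \<in> Gens P \<Longrightarrow> gcod P g \<in> lists (Atoms P)"
begin

lemma wft_atoms: "wft P t \<Longrightarrow> tdom P t \<in> lists (Atoms P) \<and> tcod P t \<in> lists (Atoms P)"
  by (induction t) (auto simp: gdom_atoms gcod_atoms)

lemma tdom_atoms [simp]: "wft P t \<Longrightarrow> tdom P t \<in> lists (Atoms P)"
  and tcod_atoms [simp]: "wft P t \<Longrightarrow> tcod P t \<in> lists (Atoms P)"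
  using wft_atoms by blast+

lemma teq_wf: "teq P s t \<Longrightarrow> wft P s \<and> wft P t \<and> tdom P s = tdom P t \<and> tcod P s = tcod P t"
  by (induction rule: teq.induct) auto

lemma cls_eq: "teq P s t \<Longrightarrow> cls P s = cls P t"
  unfolding cls_def using teq_sym teq_trans by blast

lemma teq_rep: "wft P t \<Longrightarrow> teq P t (rep (cls P t))"
  unfolding rep_def cls_def by (rule someI2[where a = t]) (auto intro: teq_refl teq_sym)

lemma cls_rep: "wft P t \<Longrightarrow> cls P (rep (cls P t)) = cls P t"
  using cls_eq[OF teq_rep] by simp

lemma rep_typing:
  "wft P t \<Longrightarrow> wft P (rep (cls P t)) \<and> tdom P (rep (cls P t)) = tdom P t
     \<and> tcod P (rep (cls P t)) = tcod P t"
  using teq_wf[OF teq_rep] by simp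

lemma Ob_presented: "Ob (presented P) = lists (Atoms P)"
  and Plus_presented: "Plus (presented P) u v = u @ v"
  and Zero_presented: "Zero (presented P) = []"
  and Idm_presented: "Idm (presented P) u = cls P (IdT u)"
  and Beta_presented: "Beta (presented P) u v = cls P (SymT u v)"
  unfolding presented_def by simp_all

lemma Mor_presented: "c \<in> Mor (presented P) \<longleftrightarrow> (\<exists>t. wft P t \<and> c = cls P t)"
  unfolding presented_def by auto

lemma cls_mor [simp]: "wft P t \<Longrightarrow> cls P t \<in> Mor (presented P)"
  and Dom_cls [simp]: "wft P t \<Longrightarrow> Dom (presented P) (cls P t) = tdom P t"
  and Cod_cls [simp]: "wft P t \<Longrightarrow> Cod (presented P) (cls P t) = tcod P t"
  unfolding presented_def by (auto simp: rep_typing)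

lemma Cmp_cls:
  assumes "wft P s" "wft P t" "tdom P s = tcod P t"
  shows "Cmp (presented P) (cls P s) (cls P t) = cls P (CmpT s t)"
proof -
  have "teq P (CmpT s t) (CmpT (rep (cls P s)) (rep (cls P t)))"
    using assms by (intro teq_cmp teq_rep)
  then show ?thesis by (simp add: presented_def cls_eq)
qed

lemma PlusM_cls:
  assumes "wft P s" "wft P t"
  shows "PlusM (presented P) (cls P s) (cls P t) = cls P (SumT s t)"
proof -
  have "teq P (SumT s t) (SumT (rep (cls P s)) (rep (cls P t)))"
    using assms by (intro teq_sum teq_rep)
  then show ?thesis by (simp add: presented_def cls_eq)
qed

lemma Mor_presentedE:
  assumes "c \<in> Mor (presented P)"
  obtains t where "wft P t" "c = cls P t"
  using assms by (auto simp: Mor_presented)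

lemmas cls_axioms = teq_id_left[THEN cls_eq] teq_id_right[THEN cls_eq] teq_sum_id[THEN cls_eq]
  teq_assoc[THEN cls_eq, symmetric] teq_interchange[THEN cls_eq] teq_sum_assoc[THEN cls_eq]
  teq_zero_left[THEN cls_eq] teq_zero_right[THEN cls_eq] teq_beta_nat[THEN cls_eq]
  teq_beta_inv[THEN cls_eq] teq_beta_plus[THEN cls_eq]

lemma permutative_presented: "permutative (presented P)"
proof -
  note [simp] = Ob_presented Plus_presented Zero_presented Idm_presented Beta_presented
    Cmp_cls PlusM_cls
  show ?thesis
    by unfold_locales (((elim Mor_presentedE)?; simp add: cls_axioms)+)
qed

sublocale permutative "presented P" by (rule permutative_presented)

definition gen :: "'g \<Rightarrow> ('x, 'g) pterm set" where
  "gen g = cls P (GenT g)"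

lemma gen_typing [simp]:
  assumes "g \<in> Gens P"
  shows "gen g \<in> Mor (presented P)" "Dom (presented P) (gen g) = gdom P g"
    "Cod (presented P) (gen g) = gcod P g"
  using assms by (simp_all add: gen_def)

lemmas presented_simps [simp] = Ob_presented Plus_presented Zero_presented

lemmas nil_plusM [simp] = zero_plusM[unfolded Zero_presented]
  and plusM_nil [simp] = plusM_zero[unfolded Zero_presented]

lemma ev_ob_presented: "ev_ob (presented P) (\<lambda>x. [x]) u = u"
  by (induction u) (auto simp: ev_ob_def)

lemma ev_presented: "wft P t \<Longrightarrow> ev (presented P) (\<lambda>x. [x]) gen t = cls P t"
  by (induction t)
    (simp_all add: gen_def ev_ob_presented Idm_presented Beta_presented Cmp_cls PlusM_cls)

text \<open>Evaluating a term in its own presented category returns its class. Once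
  \<open>ev\<close> is unfolded by \<open>simp\<close>, a relation between formal terms thus becomes
  an equation between composites and sums of generators.\<close>

lemma relation:
  "\<lbrakk>Rels P s t; wft P s; wft P t; tdom P s = tdom P t; tcod P s = tcod P t\<rbrakk>
    \<Longrightarrow> ev (presented P) (\<lambda>x. [x]) gen s = ev (presented P) (\<lambda>x. [x]) gen t"
  by (simp add: ev_presented cls_eq teq_rel)

end

text \<open>The values on generators have matching sources and targets, with no condition from the
  relations. Where the relations are respected, this enters later as the assumption
  \<open>respects\<close>, which upgrades \<open>extend\<close> from a graph map to a strict
  functor.\<close>

locale term_model = P: well_formed P + D: permutative D
  for P :: "('x, 'g) presentation" and D :: "('p, 'n) pcat" +
  fixes h :: "'x \<Rightarrow> 'p" and k :: "'g \<Rightarrow> 'n"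
  assumes h_ob [simp]: "x \<in> Atoms P \<Longrightarrow> h x \<in> Ob D"
    and k_mor [simp]: "g \<in> Gens P \<Longrightarrow> k g \<in> Mor D"
    and k_dom [simp]: "g \<in> Gens P \<Longrightarrow> Dom D (k g) = ev_ob D h (gdom P g)"
    and k_cod [simp]: "g \<in> Gens P \<Longrightarrow> Cod D (k g) = ev_ob D h (gcod P g)"
begin

lemma ev_ob_Nil [simp]: "ev_ob D h [] = Zero D"
  and ev_ob_Cons: "ev_ob D h (x # u) = Plus D (h x) (ev_ob D h u)"
  unfolding ev_ob_def by simp_all

lemma ev_ob_ob [simp]: "u \<in> lists (Atoms P) \<Longrightarrow> ev_ob D h u \<in> Ob D"
  by (induction u) (auto simp: ev_ob_Cons)

lemma ev_ob_append [simp]: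
  "\<lbrakk>u \<in> lists (Atoms P); v \<in> lists (Atoms P)\<rbrakk>
    \<Longrightarrow> ev_ob D h (u @ v) = Plus D (ev_ob D h u) (ev_ob D h v)"
  by (induction u) (auto simp: ev_ob_Cons D.plus_assoc)

lemma ev_typing:
  "wft P t \<Longrightarrow> ev D h k t \<in> Mor D \<and> Dom D (ev D h k t) = ev_ob D h (tdom P t)
     \<and> Cod D (ev D h k t) = ev_ob D h (tcod P t)"
  by (induction t) auto

lemma ev_simps [simp]:
  assumes "wft P t"
  shows "ev D h k t \<in> Mor D" "Dom D (ev D h k t) = ev_ob D h (tdom P t)"
    "Cod D (ev D h k t) = ev_ob D h (tcod P t)"
  using ev_typing[OF assms] by simp_all

text \<open>Typing survives the choice of a representative because equal terms share source and
  target, and on objects \<open>ev_ob\<close> is the monoid homomorphism out of lists.\<close>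

lemma graph_map_extend: "graph_map (presented P) D (extend D h k)"
  by unfold_locales (auto simp: P.Mor_presented extend_def P.rep_typing)

context
  assumes respects: "\<And>s t. \<lbrakk>Rels P s t; wft P s; wft P t; tdom P s = tdom P t; tcod P s = tcod P t\<rbrakk>
    \<Longrightarrow> ev D h k s = ev D h k t"
begin

lemma ev_teq: "teq P s t \<Longrightarrow> ev D h k s = ev D h k t"
proof (induction rule: teq.induct)
  case (teq_rel s t)
  then show ?case by (rule respects)
next
  case (teq_assoc r s t)
  then show ?case by (simp add: D.cmp_assoc)
next
  case (teq_interchange s t s' t')
  then show ?case by (simp add: D.plus_cmp)
next
  case (teq_sum_assoc r s t)
  then show ?case by (simp add: D.plusM_assoc)
next
  case (teq_beta_nat s t)
  then show ?case by (simp add: D.beta_natural)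
next
  case (teq_beta_inv u v)
  then show ?case by (simp add: D.beta_inv)
next
  case (teq_beta_plus u v w)
  then show ?case by (simp add: D.beta_plus)
qed simp_all

lemma Fm_extend_cls: "wft P t \<Longrightarrow> Fm (extend D h k) (cls P t) = ev D h k t"
  using ev_teq[OF P.teq_rep[of t]] by (simp add: extend_def)

lemma Fm_extend_gen: "g \<in> Gens P \<Longrightarrow> Fm (extend D h k) (P.gen g) = k g"
  by (simp add: P.gen_def Fm_extend_cls)

lemma strict_functor_extend: "strict_functor (presented P) D (extend D h k)"
proof -
  interpret graph_map "presented P" D "extend D h k" by (rule graph_map_extend)
  have "Fo (extend D h k) = ev_ob D h" by (simp add: extend_def)
  then show ?thesis
    by unfold_locales
      (auto simp: P.Mor_presented P.Idm_presented P.Beta_presented P.Cmp_cls P.PlusM_cls Fm_extend_cls)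
qed

end

end

text \<open>A symmetric monoidal functor \<open>K\<close> out of a presented permutative category is compared with the
  composite of a strict functor \<open>G\<close> and the evaluation of terms; naturality of a
  monoidal \<open>\<theta>\<close> need only be known on generators, even if the evaluation does not respect
  the relations.\<close>

locale comparison = term_model P D h k + G: strict_functor D E G
  for P :: "('x, 'g) presentation" and D :: "('p, 'n) pcat" and h k
    and E :: "('q, 'l) pcat" and G +
  fixes Ko :: "'x list \<Rightarrow> 'q" and Km :: "('x, 'g) pterm set \<Rightarrow> 'l"
    and \<delta> :: "'x list \<Rightarrow> 'x list \<Rightarrow> 'l" and \<theta> :: "'x list \<Rightarrow> 'l"
  assumes Ko_ob [simp]: "u \<in> lists (Atoms P) \<Longrightarrow> Ko u \<in> Ob E"
    and Km_mor [simp]: "c \<in> Mor (presented P) \<Longrightarrow> Km c \<in> Mor E"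
    and Km_dom [simp]: "c \<in> Mor (presented P) \<Longrightarrow> Dom E (Km c) = Ko (Dom (presented P) c)"
    and Km_cod [simp]: "c \<in> Mor (presented P) \<Longrightarrow> Cod E (Km c) = Ko (Cod (presented P) c)"
    and Km_id: "u \<in> lists (Atoms P) \<Longrightarrow> Km (Idm (presented P) u) = Idm E (Ko u)"
    and Km_cmp: "\<lbrakk>c \<in> Mor (presented P); d \<in> Mor (presented P);
        Dom (presented P) d = Cod (presented P) c\<rbrakk>
      \<Longrightarrow> Km (Cmp (presented P) d c) = Cmp E (Km d) (Km c)"
    and \<delta>_mor [simp]: "\<lbrakk>u \<in> lists (Atoms P); v \<in> lists (Atoms P)\<rbrakk> \<Longrightarrow> \<delta> u v \<in> Mor E"
    and \<delta>_dom [simp]: "\<lbrakk>u \<in> lists (Atoms P); v \<in> lists (Atoms P)\<rbrakk>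
      \<Longrightarrow> Dom E (\<delta> u v) = Plus E (Ko u) (Ko v)"
    and \<delta>_cod [simp]: "\<lbrakk>u \<in> lists (Atoms P); v \<in> lists (Atoms P)\<rbrakk> \<Longrightarrow> Cod E (\<delta> u v) = Ko (u @ v)"
    and \<delta>_nat: "\<lbrakk>c \<in> Mor (presented P); d \<in> Mor (presented P)\<rbrakk>
      \<Longrightarrow> Cmp E (Km (PlusM (presented P) c d)) (\<delta> (Dom (presented P) c) (Dom (presented P) d))
        = Cmp E (\<delta> (Cod (presented P) c) (Cod (presented P) d)) (PlusM E (Km c) (Km d))"
    and \<delta>_sym: "\<lbrakk>u \<in> lists (Atoms P); v \<in> lists (Atoms P)\<rbrakk>
      \<Longrightarrow> Cmp E (Km (Beta (presented P) u v)) (\<delta> u v) = Cmp E (\<delta> v u) (Beta E (Ko u) (Ko v))"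
    and \<theta>_mor [simp]: "u \<in> lists (Atoms P) \<Longrightarrow> \<theta> u \<in> Mor E"
    and \<theta>_dom [simp]: "u \<in> lists (Atoms P) \<Longrightarrow> Dom E (\<theta> u) = Fo G (ev_ob D h u)"
    and \<theta>_cod [simp]: "u \<in> lists (Atoms P) \<Longrightarrow> Cod E (\<theta> u) = Ko u"
    and \<theta>_append: "\<lbrakk>u \<in> lists (Atoms P); v \<in> lists (Atoms P)\<rbrakk>
      \<Longrightarrow> \<theta> (u @ v) = Cmp E (\<delta> u v) (PlusM E (\<theta> u) (\<theta> v))"
    and \<theta>_gen: "g \<in> Gens P
      \<Longrightarrow> Cmp E (Km (P.gen g)) (\<theta> (gdom P g)) = Cmp E (\<theta> (gcod P g)) (Fm G (k g))"
begin

text \<open>Induction on the term and not on the congruence, so that no equation between terms has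
  to hold after evaluation in \<open>D\<close>. Composites paste squares, sums use
  \<open>\<delta>_nat\<close>, and symmetries use \<open>\<delta>_sym\<close> followed by naturality
  of the symmetry of \<open>E\<close>.\<close>

theorem natural_term:
  "wft P t \<Longrightarrow> Cmp E (Km (cls P t)) (\<theta> (tdom P t)) = Cmp E (\<theta> (tcod P t)) (Fm G (ev D h k t))"
proof (induction t)
  case (GenT g)
  then show ?case using \<theta>_gen[of g] by (simp add: P.gen_def)
next
  case (IdT u)
  then show ?case by (simp add: Km_id P.Idm_presented[symmetric])
next
  case (SymT u v)
  let ?b = "Km (Beta (presented P) u v)"
  have uv: "u \<in> lists (Atoms P)" "v \<in> lists (Atoms P)" using SymT by auto
  have "Cmp E ?b (Cmp E (\<delta> u v) (PlusM E (\<theta> u) (\<theta> v)))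
      = Cmp E (Cmp E ?b (\<delta> u v)) (PlusM E (\<theta> u) (\<theta> v))"
    using uv by (intro G.cod.cmp_assoc) auto
  also have "\<dots> = Cmp E (\<delta> v u) (Cmp E (Beta E (Ko u) (Ko v)) (PlusM E (\<theta> u) (\<theta> v)))"
    unfolding \<delta>_sym[OF uv] using uv by (intro G.cod.cmp_assoc[symmetric]) auto
  also have "Cmp E (Beta E (Ko u) (Ko v)) (PlusM E (\<theta> u) (\<theta> v))
      = Cmp E (PlusM E (\<theta> v) (\<theta> u)) (Beta E (Fo G (ev_ob D h u)) (Fo G (ev_ob D h v)))"
    using uv by (intro G.cod.beta_natural) auto
  also have "Cmp E (\<delta> v u) \<dots> = Cmp E (\<theta> (v @ u)) (Fm G (ev D h k (SymT u v)))"
    using uv by (simp add: \<theta>_append G.cod.cmp_assoc)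
  finally show ?case using uv by (simp add: \<theta>_append P.Beta_presented)
next
  case (CmpT s t)
  then have st: "wft P s" "wft P t" "tdom P s = tcod P t" by auto
  have "Cmp E (Km (cls P (CmpT s t))) (\<theta> (tdom P t))
      = Cmp E (Cmp E (Km (cls P s)) (Km (cls P t))) (\<theta> (tdom P t))"
    using st by (simp add: Km_cmp P.Cmp_cls[symmetric])
  also have "\<dots> = Cmp E (Km (cls P s)) (Cmp E (Km (cls P t)) (\<theta> (tdom P t)))"
    using st by (intro G.cod.cmp_assoc[symmetric]) auto
  also have "\<dots> = Cmp E (Km (cls P s)) (Cmp E (\<theta> (tcod P t)) (Fm G (ev D h k t)))"
    using CmpT st by simp
  also have "\<dots> = Cmp E (Cmp E (Km (cls P s)) (\<theta> (tdom P s))) (Fm G (ev D h k t))"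
    unfolding st(3) using st by (intro G.cod.cmp_assoc) auto
  also have "\<dots> = Cmp E (Cmp E (\<theta> (tcod P s)) (Fm G (ev D h k s))) (Fm G (ev D h k t))"
    using CmpT st by simp
  also have "\<dots> = Cmp E (\<theta> (tcod P s)) (Cmp E (Fm G (ev D h k s)) (Fm G (ev D h k t)))"
    using st by (intro G.cod.cmp_assoc[symmetric]) auto
  finally show ?case using st by simp
next
  case (SumT s t)
  then have st: "wft P s" "wft P t" by auto
  let ?s = "tdom P s" and ?t = "tdom P t" and ?s' = "tcod P s" and ?t' = "tcod P t"
  have K: "Km (cls P (SumT s t)) = Km (PlusM (presented P) (cls P s) (cls P t))"
    using st by (simp add: P.PlusM_cls)
  have "Cmp E (Km (PlusM (presented P) (cls P s) (cls P t))) (Cmp E (\<delta> ?s ?t) (PlusM E (\<theta> ?s) (\<theta> ?t)))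
     = Cmp E (Cmp E (Km (PlusM (presented P) (cls P s) (cls P t))) (\<delta> ?s ?t)) (PlusM E (\<theta> ?s) (\<theta> ?t))"
    using st by (intro G.cod.cmp_assoc) auto
  also have "\<dots> = Cmp E (Cmp E (\<delta> ?s' ?t') (PlusM E (Km (cls P s)) (Km (cls P t)))) (PlusM E (\<theta> ?s) (\<theta> ?t))"
    using st \<delta>_nat[of "cls P s" "cls P t"] by simp
  also have "\<dots> = Cmp E (\<delta> ?s' ?t') (Cmp E (PlusM E (Km (cls P s)) (Km (cls P t))) (PlusM E (\<theta> ?s) (\<theta> ?t)))"
    using st by (intro G.cod.cmp_assoc[symmetric]) auto
  also have "Cmp E (PlusM E (Km (cls P s)) (Km (cls P t))) (PlusM E (\<theta> ?s) (\<theta> ?t))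
     = PlusM E (Cmp E (Km (cls P s)) (\<theta> ?s)) (Cmp E (Km (cls P t)) (\<theta> ?t))"
    using st by (intro G.cod.plus_cmp[symmetric]) auto
  also have "\<dots> = PlusM E (Cmp E (\<theta> ?s') (Fm G (ev D h k s))) (Cmp E (\<theta> ?t') (Fm G (ev D h k t)))"
    using SumT st by simp
  also have "\<dots> = Cmp E (PlusM E (\<theta> ?s') (\<theta> ?t')) (PlusM E (Fm G (ev D h k s)) (Fm G (ev D h k t)))"
    using st by (intro G.cod.plus_cmp) auto
  also have "Cmp E (\<delta> ?s' ?t') \<dots> = Cmp E (Cmp E (\<delta> ?s' ?t') (PlusM E (\<theta> ?s') (\<theta> ?t')))
      (PlusM E (Fm G (ev D h k s)) (Fm G (ev D h k t)))"
    using st by (intro G.cod.cmp_assoc) auto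
  finally show ?case using st by (simp add: K \<theta>_append)
qed

end

locale atomwise = term_model P D h k + G: strict_functor D "presented P" G
  for P :: "('x, 'g) presentation" and D :: "('p, 'n) pcat" and h k and G +
  fixes \<theta> :: "'x \<Rightarrow> ('x, 'g) pterm set"
  assumes th_epi: "x \<in> Atoms P \<Longrightarrow> P.split_epi (\<theta> x)"
    and th_dom [simp]: "x \<in> Atoms P \<Longrightarrow> Dom (presented P) (\<theta> x) = Fo G (h x)"
    and th_cod [simp]: "x \<in> Atoms P \<Longrightarrow> Cod (presented P) (\<theta> x) = [x]"
begin

abbreviation th_sum :: "'x list \<Rightarrow> ('x, 'g) pterm set" where
  "th_sum u \<equiv> sumM (presented P) (map \<theta> u)"

lemma th_mor [simp]: "x \<in> Atoms P \<Longrightarrow> \<theta> x \<in> Mor (presented P)"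
  using th_epi P.split_epi_mor by blast

lemma th_sum_epi [simp]: "u \<in> lists (Atoms P) \<Longrightarrow> P.split_epi (th_sum u)"
  by (induction u) (auto simp: sumM_simps intro!: P.split_epi_id P.split_epi_plus th_epi)

lemma th_sum_mor [simp]: "u \<in> lists (Atoms P) \<Longrightarrow> th_sum u \<in> Mor (presented P)"
  using th_sum_epi P.split_epi_mor by blast

lemma th_sum_dom [simp]:
    "u \<in> lists (Atoms P) \<Longrightarrow> Dom (presented P) (th_sum u) = Fo G (ev_ob D h u)"
  and th_sum_cod [simp]: "u \<in> lists (Atoms P) \<Longrightarrow> Cod (presented P) (th_sum u) = u"
  using G.map_zero by (induction u) (auto simp: sumM_simps ev_ob_Cons)

lemma th_sum_append [simp]:
  "\<lbrakk>u \<in> lists (Atoms P); v \<in> lists (Atoms P)\<rbrakk>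
    \<Longrightarrow> sumM (presented P) (map \<theta> u @ map \<theta> v) = PlusM (presented P) (th_sum u) (th_sum v)"
proof (induction u)
  case Nil
  then show ?case using P.zero_plusM[of "th_sum v"] by (simp add: sumM_simps)
next
  case (Cons x u)
  then show ?case by (simp add: sumM_simps P.plusM_assoc)
qed

lemma left_equivalence_extend:
  assumes gens: "\<And>g. g \<in> Gens P \<Longrightarrow> Cmp (presented P) (P.gen g) (th_sum (gdom P g))
      = Cmp (presented P) (th_sum (gcod P g)) (Fm G (k g))"
  shows "left_equivalence (presented P) D (extend D h k) G th_sum"
proof -
  interpret graph_map "presented P" D "extend D h k" by (rule graph_map_extend)
  \<comment> \<open>The functor compared here is the identity of the presented category, with
    identities as constraints; only the condition on generators carries content.\<close>
  have "comparison P D h k (presented P) G (\<lambda>u. u) (\<lambda>c. c)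
      (\<lambda>u v. Idm (presented P) (u @ v)) th_sum"
    by unfold_locales (simp_all add: gens)
  note natural = comparison.natural_term[OF this]
  show ?thesis
  proof unfold_locales
    fix f assume "f \<in> Mor (presented P)"
    then obtain t where t: "wft P t" "f = cls P t" by (auto simp: P.Mor_presented)
    \<comment> \<open>\<open>extend\<close> is by definition the evaluation of this very term, so
      naturality for this one term already is naturality at \<open>f\<close>.\<close>
    let ?r = "rep f"
    have r: "wft P ?r" "cls P ?r = f" "tdom P ?r = Dom (presented P) f" "tcod P ?r = Cod (presented P) f"
      using t by (auto simp: P.rep_typing P.cls_rep)
    show "Cmp (presented P) f (th_sum (Dom (presented P) f))
      = Cmp (presented P) (th_sum (Cod (presented P) f)) (Fm G (Fm (extend D h k) f))"
      using natural[OF r(1)] r by (simp add: extend_def)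
  qed (auto simp: extend_def sumM_simps)
qed

end

section \<open>Tensor products\<close>

locale tensor_pair = A: permutative A + B: permutative B
  for A :: "('a, 'f) pcat" and B :: "('b, 'g) pcat"
begin

lemma tensor_pres_simps [simp]:
  "Atoms (tensor_pres A B) = Ob A \<times> Ob B"
  "g \<in> Gens (tensor_pres A B) \<longleftrightarrow> tensor_gens A B g"
  "gdom (tensor_pres A B) = tensor_dom A B"
  "gcod (tensor_pres A B) = tensor_cod A B"
  "Rels (tensor_pres A B) = tensor_rels A B"
  by (simp_all add: tensor_pres_def)

sublocale well_formed "tensor_pres A B"
proof
  fix g assume "g \<in> Gens (tensor_pres A B)"
  then show "gdom (tensor_pres A B) g \<in> lists (Atoms (tensor_pres A B))"
    and "gcod (tensor_pres A B) g \<in> lists (Atoms (tensor_pres A B))"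
    by (cases g; simp)+
qed

abbreviation AB where "AB \<equiv> presented (tensor_pres A B)"

abbreviation cmp (infixr "\<bullet>" 60) where "g \<bullet> f \<equiv> Cmp AB g f"

abbreviation plus (infixr "\<oplus>" 65) where "f \<oplus> g \<equiv> PlusM AB f g"

lemmas tensor_relation = relation[unfolded tensor_pres_simps]

lemmas ev_atoms [simp] = ev_ob_presented

section \<open>The tensor relations as equations between morphisms\<close>

lemma ten_cmp:
  "\<lbrakk>f \<in> Mor A; f' \<in> Mor A; g \<in> Mor B; g' \<in> Mor B; Dom A f' = Cod A f; Dom B g' = Cod B g\<rbrakk>
    \<Longrightarrow> gen (Ten (Cmp A f' f) (Cmp B g' g)) = gen (Ten f' g') \<bullet> gen (Ten f g)"
  using tensor_relation[OF tensor_rels.ten_cmp] by simp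

lemma ten_id:
  "\<lbrakk>a \<in> Ob A; b \<in> Ob B\<rbrakk> \<Longrightarrow> gen (Ten (Idm A a) (Idm B b)) = Idm AB [(a, b)]"
  using tensor_relation[OF tensor_rels.ten_id] by simp

lemma dl_inverse: "\<lbrakk>a \<in> Ob A; b \<in> Ob B; b' \<in> Ob B\<rbrakk> \<Longrightarrow> inverse_pair (gen (DL a b b')) (gen (DLi a b b'))"
  using tensor_relation[OF tensor_rels.dl_inv1[of a A b B b']]
    tensor_relation[OF tensor_rels.dl_inv2[of a A b B b']]
  by (simp add: inverse_pair_def)

lemma dr_inverse: "\<lbrakk>b \<in> Ob B; a \<in> Ob A; a' \<in> Ob A\<rbrakk> \<Longrightarrow> inverse_pair (gen (DR b a a')) (gen (DRi b a a'))"
  using tensor_relation[OF tensor_rels.dr_inv1[of b B a A a']]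
    tensor_relation[OF tensor_rels.dr_inv2[of b B a A a']]
  by (simp add: inverse_pair_def)

lemma zl_inverse: "a \<in> Ob A \<Longrightarrow> inverse_pair (gen (ZL a)) (gen (ZLi a))"
  using tensor_relation[OF tensor_rels.zl_inv1[of a A B]] tensor_relation[OF tensor_rels.zl_inv2[of a A B]]
  by (simp add: inverse_pair_def)

lemma zr_inverse: "b \<in> Ob B \<Longrightarrow> inverse_pair (gen (ZR b)) (gen (ZRi b))"
  using tensor_relation[OF tensor_rels.zr_inv1[of b B A]] tensor_relation[OF tensor_rels.zr_inv2[of b B A]]
  by (simp add: inverse_pair_def)

text \<open>The sources are variables fixed by premises, so that the equation still rewrites after
  \<open>simp\<close> has normalised \<open>Dom A f\<close> and \<open>Dom B g\<close>. The other
  naturality rules have the same form.\<close>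

lemma dl_nat:
  "\<lbrakk>f \<in> Mor A; g \<in> Mor B; g' \<in> Mor B; Dom A f = a; Dom B g = b; Dom B g' = b'\<rbrakk>
    \<Longrightarrow> gen (Ten f (PlusM B g g')) \<bullet> gen (DL a b b')
      = gen (DL (Cod A f) (Cod B g) (Cod B g')) \<bullet> (gen (Ten f g) \<oplus> gen (Ten f g'))"
  using tensor_relation[OF tensor_rels.dl_nat[of f A g B g']] by auto

lemma dr_nat:
  "\<lbrakk>g \<in> Mor B; f \<in> Mor A; f' \<in> Mor A; Dom B g = b; Dom A f = a; Dom A f' = a'\<rbrakk>
    \<Longrightarrow> gen (Ten (PlusM A f f') g) \<bullet> gen (DR b a a')
      = gen (DR (Cod B g) (Cod A f) (Cod A f')) \<bullet> (gen (Ten f g) \<oplus> gen (Ten f' g))"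
  using tensor_relation[OF tensor_rels.dr_nat[of g B f A f']] by auto

lemma zl_nat:
  "\<lbrakk>f \<in> Mor A; Dom A f = a\<rbrakk> \<Longrightarrow> gen (Ten f (Idm B (Zero B))) \<bullet> gen (ZL a) = gen (ZL (Cod A f))"
  using tensor_relation[OF tensor_rels.zl_nat[of f A B]] by auto

lemma zr_nat:
  "\<lbrakk>g \<in> Mor B; Dom B g = b\<rbrakk> \<Longrightarrow> gen (Ten (Idm A (Zero A)) g) \<bullet> gen (ZR b) = gen (ZR (Cod B g))"
  using tensor_relation[OF tensor_rels.zr_nat[of g B A]] by auto

lemma dl_assoc:
  "\<lbrakk>a \<in> Ob A; b \<in> Ob B; b' \<in> Ob B; b'' \<in> Ob B\<rbrakk>
    \<Longrightarrow> gen (DL a (Plus B b b') b'') \<bullet> (gen (DL a b b') \<oplus> Idm AB [(a, b'')])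
      = gen (DL a b (Plus B b' b'')) \<bullet> (Idm AB [(a, b)] \<oplus> gen (DL a b' b''))"
  \<comment> \<open>The two composites have a common target only through strict associativity in
    \<open>B\<close>.\<close>
  using tensor_relation[OF tensor_rels.dl_assoc[of a A b B b' b'']] by (simp add: B.plus_assoc)

lemma dl_unit_left:
  "\<lbrakk>a \<in> Ob A; b \<in> Ob B\<rbrakk> \<Longrightarrow> gen (DL a (Zero B) b) \<bullet> (gen (ZL a) \<oplus> Idm AB [(a, b)]) = Idm AB [(a, b)]"
  using tensor_relation[OF tensor_rels.dl_unit_left[of a A b B]] by simp

lemma dl_unit_right:
  "\<lbrakk>a \<in> Ob A; b \<in> Ob B\<rbrakk> \<Longrightarrow> gen (DL a b (Zero B)) \<bullet> (Idm AB [(a, b)] \<oplus> gen (ZL a)) = Idm AB [(a, b)]"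
  using tensor_relation[OF tensor_rels.dl_unit_right[of a A b B]] by simp

lemma dl_sym:
  "\<lbrakk>a \<in> Ob A; b \<in> Ob B; b' \<in> Ob B\<rbrakk>
    \<Longrightarrow> gen (Ten (Idm A a) (Beta B b b')) \<bullet> gen (DL a b b')
      = gen (DL a b' b) \<bullet> Beta AB [(a, b)] [(a, b')]"
  using tensor_relation[OF tensor_rels.dl_sym[of a A b B b']] by simp

lemma dr_assoc:
  "\<lbrakk>b \<in> Ob B; a \<in> Ob A; a' \<in> Ob A; a'' \<in> Ob A\<rbrakk>
    \<Longrightarrow> gen (DR b (Plus A a a') a'') \<bullet> (gen (DR b a a') \<oplus> Idm AB [(a'', b)])
      = gen (DR b a (Plus A a' a'')) \<bullet> (Idm AB [(a, b)] \<oplus> gen (DR b a' a''))"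
  using tensor_relation[OF tensor_rels.dr_assoc[of b B a A a' a'']] by (simp add: A.plus_assoc)

lemma dr_unit_left:
  "\<lbrakk>b \<in> Ob B; a \<in> Ob A\<rbrakk> \<Longrightarrow> gen (DR b (Zero A) a) \<bullet> (gen (ZR b) \<oplus> Idm AB [(a, b)]) = Idm AB [(a, b)]"
  using tensor_relation[OF tensor_rels.dr_unit_left[of b B a A]] by simp

lemma dr_unit_right:
  "\<lbrakk>b \<in> Ob B; a \<in> Ob A\<rbrakk> \<Longrightarrow> gen (DR b a (Zero A)) \<bullet> (Idm AB [(a, b)] \<oplus> gen (ZR b)) = Idm AB [(a, b)]"
  using tensor_relation[OF tensor_rels.dr_unit_right[of b B a A]] by simp

lemma dr_sym:
  "\<lbrakk>b \<in> Ob B; a \<in> Ob A; a' \<in> Ob A\<rbrakk>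
    \<Longrightarrow> gen (Ten (Beta A a a') (Idm B b)) \<bullet> gen (DR b a a')
      = gen (DR b a' a) \<bullet> Beta AB [(a, b)] [(a', b)]"
  using tensor_relation[OF tensor_rels.dr_sym[of b B a A a']] by simp

lemma dl_dr:
  "\<lbrakk>a \<in> Ob A; a' \<in> Ob A; b \<in> Ob B; b' \<in> Ob B\<rbrakk>
    \<Longrightarrow> gen (DL (Plus A a a') b b') \<bullet> (gen (DR b a a') \<oplus> gen (DR b' a a'))
      = gen (DR (Plus B b b') a a') \<bullet> (gen (DL a b b') \<oplus> gen (DL a' b b'))
        \<bullet> (Idm AB [(a, b)] \<oplus> Beta AB [(a', b)] [(a, b')] \<oplus> Idm AB [(a', b')])"
  using tensor_relation[OF tensor_rels.dl_dr[of a A a' b B b']] by simp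

lemma zl_zr: "gen (ZL (Zero A)) = gen (ZR (Zero B))"
  using tensor_relation[OF tensor_rels.zl_zr] by simp

lemma dr_zl:
  "\<lbrakk>a \<in> Ob A; a' \<in> Ob A\<rbrakk>
    \<Longrightarrow> gen (DR (Zero B) a a') \<bullet> (gen (ZL a) \<oplus> gen (ZL a')) = gen (ZL (Plus A a a'))"
  using tensor_relation[OF tensor_rels.dr_zl[of a A a' B]] by simp

lemma dl_zr:
  "\<lbrakk>b \<in> Ob B; b' \<in> Ob B\<rbrakk>
    \<Longrightarrow> gen (DL (Zero A) b b') \<bullet> (gen (ZR b) \<oplus> gen (ZR b')) = gen (ZR (Plus B b b'))"
  using tensor_relation[OF tensor_rels.dl_zr[of b B b' A]] by simp

lemmas inverses = dl_inverse dr_inverse zl_inverse zr_inverse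

lemma inverse_cmp:
  "inverse_pair f g \<Longrightarrow> g \<bullet> f = Idm AB (Dom AB f)"
  "inverse_pair f g \<Longrightarrow> f \<bullet> g = Idm AB (Cod AB f)"
  unfolding inverse_pair_def by blast+

lemmas tensor_eqs = ten_cmp ten_id inverses[THEN inverse_cmp(1)] inverses[THEN inverse_cmp(2)]
  dl_nat dr_nat zl_nat zr_nat dl_assoc dl_unit_left dl_unit_right dl_sym
  dr_assoc dr_unit_left dr_unit_right dr_sym dl_dr zl_zr dr_zl dl_zr

end

text \<open>Graph maps are the right generality: \<open>Phi_iter\<close> is tensored with itself at
  every node, and it is treated only as a graph map.\<close>

locale tensor_maps = F: graph_map A A' F + F': graph_map B B' F'
  for A :: "('a, 'f) pcat" and A' :: "('c, 'h) pcat" and F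
    and B :: "('b, 'g) pcat" and B' :: "('d, 'k) pcat" and F'
begin

sublocale T: tensor_pair A B by unfold_locales
sublocale T': tensor_pair A' B' by unfold_locales

abbreviation "ten_ob \<equiv> \<lambda>(x, y). [(Fo F x, Fo F' y)]"
abbreviation "ten_gen \<equiv> \<lambda>g. T'.gen (map_tgen (Fo F) (Fm F) (Fo F') (Fm F') g)"

lemma ev_ob_ten [simp]: "ev_ob T'.AB ten_ob u = map (map_prod (Fo F) (Fo F')) u"
  by (induction u) (auto simp: ev_ob_def)

sublocale M: term_model "tensor_pres A B" T'.AB ten_ob ten_gen
proof unfold_locales
  fix g assume "g \<in> Gens (tensor_pres A B)"
  then show "ten_gen g \<in> Mor T'.AB" "Dom T'.AB (ten_gen g) = ev_ob T'.AB ten_ob (gdom (tensor_pres A B) g)"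
    "Cod T'.AB (ten_gen g) = ev_ob T'.AB ten_ob (gcod (tensor_pres A B) g)"
    by (cases g; simp)+
qed auto

lemma tensor_func_eq: "tensor_func A' B' F F' = extend T'.AB ten_ob ten_gen"
  by (simp add: tensor_func_def tensor_def T'.gen_def)

end

text \<open>Strictness turns the image of each defining relation into the relation of the same name
  for the image objects and morphisms, so one simplification with \<open>tensor_eqs\<close> covers
  all of them.\<close>

lemma strict_functor_tensor:
  assumes "strict_functor A A' F" "strict_functor B B' F'"
  shows "strict_functor (A \<otimes>\<^sub>P B) (A' \<otimes>\<^sub>P B') (tensor_func A' B' F F')"
proof -
  interpret F: strict_functor A A' F by fact
  interpret F': strict_functor B B' F' by fact
  interpret tensor_maps A A' F B B' F' by unfold_locales
  have "ev T'.AB ten_ob ten_gen s = ev T'.AB ten_ob ten_gen t" if "Rels (tensor_pres A B) s t" for s t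
  proof -
    have "tensor_rels A B s t" using that by simp
    then show ?thesis
      by (cases rule: tensor_rels.cases) (simp_all add: T'.tensor_eqs)
  qed
  then show ?thesis
    unfolding tensor_def tensor_func_eq by (intro M.strict_functor_extend)
qed

text \<open>On \<open>Ten\<close> the square is the pair of squares of the two factors. On
  \<open>DL\<close>, \<open>DR\<close>, \<open>ZL\<close>, \<open>ZR\<close> it is the naturality of
  these constraints, after \<open>th_plus\<close> and \<open>th_zero\<close> have split the
  component at a sum or at zero. The formal inverses follow by
  \<open>inverse_pair_square\<close>.\<close>

lemma left_equivalence_tensor:
  assumes "left_equivalence A A' F G \<theta>" "left_equivalence B B' F' G' \<theta>'"
  shows "left_equivalence (A \<otimes>\<^sub>P B) (A' \<otimes>\<^sub>P B') (tensor_func A' B' F F') (tensor_func A B G G')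
    (\<lambda>u. sumM (A \<otimes>\<^sub>P B) (map (\<lambda>(x, y). cls (tensor_pres A B) (GenT (Ten (\<theta> x) (\<theta>' y)))) u))"
proof -
  interpret E: left_equivalence A A' F G \<theta> by fact
  interpret E': left_equivalence B B' F' G' \<theta>' by fact
  interpret tensor_maps A A' F B B' F' by unfold_locales
  interpret N: tensor_maps A' A G B' B G' by unfold_locales
  let ?th = "\<lambda>(x, y). T.gen (Ten (\<theta> x) (\<theta>' y))"
  have S: "strict_functor T'.AB T.AB (tensor_func A B G G')"
    using strict_functor_tensor[OF E.G.strict_functor_axioms E'.G.strict_functor_axioms]
    unfolding tensor_def .
  have respects: "ev T.AB N.ten_ob N.ten_gen s = ev T.AB N.ten_ob N.ten_gen t"
    if "Rels (tensor_pres A' B') s t" for s t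
    using that by (auto elim!: tensor_rels.cases simp: T.tensor_eqs)
  interpret S: strict_functor T'.AB T.AB "extend T.AB N.ten_ob N.ten_gen"
    using S unfolding N.tensor_func_eq .
  have Fo: "Fo (extend T.AB N.ten_ob N.ten_gen) = map (map_prod (Fo G) (Fo G'))"
    by (rule ext) (simp add: extend_def)
  have Fm: "Fm (extend T.AB N.ten_ob N.ten_gen) (T'.gen g) = N.ten_gen g"
    if "tensor_gens A' B' g" for g
    using that respects by (intro N.M.Fm_extend_gen) auto
  interpret atomwise "tensor_pres A B" T'.AB ten_ob ten_gen "extend T.AB N.ten_ob N.ten_gen" ?th
  proof unfold_locales
    fix x assume "x \<in> Atoms (tensor_pres A B)"
    then obtain a b where x: "x = (a, b)" "a \<in> Ob A" "b \<in> Ob B" by auto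
    obtain s where s: "s \<in> Mor A" "Dom A s = a" "Cod A s = Fo G (Fo F a)" "Cmp A (\<theta> a) s = Idm A a"
      using E.epi[of a] x unfolding E.F.dom.split_epi_def by auto
    obtain t where t: "t \<in> Mor B" "Dom B t = b" "Cod B t = Fo G' (Fo F' b)" "Cmp B (\<theta>' b) t = Idm B b"
      using E'.epi[of b] x unfolding E'.F.dom.split_epi_def by auto
    \<comment> \<open>The sections of the two components tensor to a section, by functoriality of
      \<open>Ten\<close>.\<close>
    have "Cmp T.AB (T.gen (Ten (\<theta> a) (\<theta>' b))) (T.gen (Ten s t)) = Idm T.AB [(a, b)]"
      using x s t by (subst T.ten_cmp[symmetric]) (auto simp: T.ten_id)
    then show "T.split_epi (?th x)"
      using x s t by (intro T.split_epiI[where t = "T.gen (Ten s t)"]) auto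
  qed (auto simp: Fo)
  have "left_equivalence T.AB T'.AB (extend T'.AB ten_ob ten_gen) (extend T.AB N.ten_ob N.ten_gen)
    (\<lambda>u. sumM T.AB (map ?th u))"
  proof (rule left_equivalence_extend)
    fix g assume g: "g \<in> Gens (tensor_pres A B)"
    then have "Fm (extend T.AB N.ten_ob N.ten_gen) (ten_gen g) = N.ten_gen (map_tgen (Fo F) (Fm F) (Fo F') (Fm F') g)"
      by (intro Fm) (cases g; simp)
    then show "Cmp T.AB (T.gen g) (th_sum (gdom (tensor_pres A B) g))
      = Cmp T.AB (th_sum (gcod (tensor_pres A B) g)) (Fm (extend T.AB N.ten_ob N.ten_gen) (ten_gen g))"
      using g
    proof (cases g)
      case (Ten f f')
      with g show ?thesis
        by (simp add: Fm sumM_simps T.ten_cmp[symmetric] E.natural E'.natural)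
    next
      case (DL a b b')
      with g show ?thesis by (simp add: Fm sumM_simps T.dl_nat)
    next
      case (DR b a a')
      with g show ?thesis by (simp add: Fm sumM_simps T.dr_nat)
    next
      case (ZL a)
      with g show ?thesis by (simp add: Fm sumM_simps T.zl_nat)
    next
      case (ZR b)
      with g show ?thesis by (simp add: Fm sumM_simps T.zr_nat)
    next
      case (DLi a b b')
      with g show ?thesis
        by (simp add: Fm sumM_simps, intro T.inverse_pair_square[OF T.dl_inverse T.dl_inverse])
          (simp_all add: T.dl_nat)
    next
      case (DRi b a a')
      with g show ?thesis
        by (simp add: Fm sumM_simps, intro T.inverse_pair_square[OF T.dr_inverse T.dr_inverse])
          (simp_all add: T.dr_nat)
    next
      \<comment> \<open>One side of the square lies over the empty sum and is the identity of
        \<open>[]\<close>; it is supplied explicitly since simplification removes it from the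
        goal.\<close>
      case (ZLi a)
      with g show ?thesis
        using T.inverse_pair_square[OF T.zl_inverse T.zl_inverse,
            of a "Fo G (Fo F a)" "Idm T.AB []" "T.gen (Ten (\<theta> a) (\<theta>' (Zero B)))"]
        by (simp add: Fm sumM_simps T.zl_nat)
    next
      case (ZRi b)
      with g show ?thesis
        using T.inverse_pair_square[OF T.zr_inverse T.zr_inverse,
            of b "Fo G' (Fo F' b)" "Idm T.AB []" "T.gen (Ten (\<theta> (Zero A)) (\<theta>' b))"]
        by (simp add: Fm sumM_simps T.zr_nat)
    qed
  qed
  then show ?thesis
    unfolding tensor_func_eq N.tensor_func_eq unfolding tensor_def T.gen_def .
qed

text \<open>For \<open>K\<close> monoidal with constraints \<open>\<delta>\<close> and
  \<open>\<zeta>\<close>, this is the canonical morphism from the sum of the sources of the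
  \<open>\<tau> x\<close> to \<open>K u\<close>, nested to the right and ending in
  \<open>\<zeta>\<close>. It is used twice, one inside the other: rows are built from
  \<open>DL\<close>, and grids from \<open>DR\<close> with rows as \<open>\<tau>\<close>.\<close>

fun lax_sum :: "('o, 'm, 'z) pcat_scheme \<Rightarrow> ('x list \<Rightarrow> 'x list \<Rightarrow> 'm) \<Rightarrow> 'm \<Rightarrow> ('x \<Rightarrow> 'm) \<Rightarrow> 'x list \<Rightarrow> 'm" where
  "lax_sum C \<delta> \<zeta> \<tau> [] = \<zeta>"
| "lax_sum C \<delta> \<zeta> \<tau> (x # u) = Cmp C (\<delta> [x] u) (PlusM C (\<tau> x) (lax_sum C \<delta> \<zeta> \<tau> u))"

locale lax_monoidal = permutative C for C :: "('o, 'm) pcat" +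
  fixes S :: "'x set" and K :: "'x list \<Rightarrow> 'o" and \<delta> :: "'x list \<Rightarrow> 'x list \<Rightarrow> 'm" and \<zeta> :: 'm
    and \<tau> :: "'x \<Rightarrow> 'm"
  assumes K_ob [simp]: "u \<in> lists S \<Longrightarrow> K u \<in> Ob C"
    and \<delta>_epi [simp]: "\<lbrakk>u \<in> lists S; v \<in> lists S\<rbrakk> \<Longrightarrow> split_epi (\<delta> u v)"
    and \<delta>_dom [simp]: "\<lbrakk>u \<in> lists S; v \<in> lists S\<rbrakk> \<Longrightarrow> Dom C (\<delta> u v) = Plus C (K u) (K v)"
    and \<delta>_cod [simp]: "\<lbrakk>u \<in> lists S; v \<in> lists S\<rbrakk> \<Longrightarrow> Cod C (\<delta> u v) = K (u @ v)"
    and \<zeta>_epi [simp]: "split_epi \<zeta>"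
    and \<zeta>_dom [simp]: "Dom C \<zeta> = Zero C"
    and \<zeta>_cod [simp]: "Cod C \<zeta> = K []"
    and \<delta>_assoc: "\<lbrakk>u \<in> lists S; v \<in> lists S; w \<in> lists S\<rbrakk>
      \<Longrightarrow> Cmp C (\<delta> (u @ v) w) (PlusM C (\<delta> u v) (Idm C (K w)))
        = Cmp C (\<delta> u (v @ w)) (PlusM C (Idm C (K u)) (\<delta> v w))"
    and \<delta>_unit: "u \<in> lists S \<Longrightarrow> Cmp C (\<delta> [] u) (PlusM C \<zeta> (Idm C (K u))) = Idm C (K u)"
    and \<tau>_epi [simp]: "x \<in> S \<Longrightarrow> split_epi (\<tau> x)"
    and \<tau>_cod [simp]: "x \<in> S \<Longrightarrow> Cod C (\<tau> x) = K [x]"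
begin

lemmas mors [simp] = \<delta>_epi[THEN split_epi_mor] \<zeta>_epi[THEN split_epi_mor] \<tau>_epi[THEN split_epi_mor]

abbreviation sm where "sm \<equiv> lax_sum C \<delta> \<zeta> \<tau>"

lemma lax_sum_epi [simp]: "u \<in> lists S \<Longrightarrow> split_epi (sm u)"
  and lax_sum_cod [simp]: "u \<in> lists S \<Longrightarrow> Cod C (sm u) = K u"
proof -
  have "split_epi (sm u) \<and> Cod C (sm u) = K u" if "u \<in> lists S"
    using that
  proof (induction u)
    case (Cons x u)
    then have x: "x \<in> S" "[x] \<in> lists S" and u: "u \<in> lists S" by auto
    then show ?case using Cons.IH by (simp add: split_epi_cmp split_epi_plus split_epi_mor)
  qed simp
  then show "u \<in> lists S \<Longrightarrow> split_epi (sm u)" "u \<in> lists S \<Longrightarrow> Cod C (sm u) = K u" by auto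
qed

lemma lax_sum_mor [simp]: "u \<in> lists S \<Longrightarrow> sm u \<in> Mor C"
  by (rule split_epi_mor) simp

text \<open>\<open>\<delta>_unit\<close> settles the empty case, and \<open>\<delta>_assoc\<close>
  moves the outer constraint past \<open>\<delta> u v\<close>. The right-nested fold thereby fits
  every splitting of the list, as \<open>\<theta>_append\<close> in \<open>comparison\<close>
  demands.\<close>

lemma lax_sum_append:
  assumes "u \<in> lists S" and v: "v \<in> lists S"
  shows "sm (u @ v) = Cmp C (\<delta> u v) (PlusM C (sm u) (sm v))"
  using assms(1)
proof (induction u)
  case Nil
  have "Cmp C (\<delta> [] v) (PlusM C \<zeta> (sm v))
      = Cmp C (\<delta> [] v) (Cmp C (PlusM C \<zeta> (Idm C (K v))) (PlusM C (Idm C (Zero C)) (sm v)))"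
    using v by (subst plus_cmp[symmetric]) (auto simp del: zero_plusM)
  also have "\<dots> = Cmp C (Cmp C (\<delta> [] v) (PlusM C \<zeta> (Idm C (K v)))) (sm v)"
    using v by (simp add: cmp_assoc)
  finally show ?case using v by (simp add: \<delta>_unit)
next
  case (Cons x u)
  then have u: "u \<in> lists S" and x: "x \<in> S" by auto
  have "sm ((x # u) @ v) = Cmp C (\<delta> [x] (u @ v)) (PlusM C (\<tau> x) (Cmp C (\<delta> u v) (PlusM C (sm u) (sm v))))"
    using Cons by simp
  also have "PlusM C (\<tau> x) (Cmp C (\<delta> u v) (PlusM C (sm u) (sm v)))
      = Cmp C (PlusM C (Idm C (K [x])) (\<delta> u v)) (PlusM C (\<tau> x) (PlusM C (sm u) (sm v)))"
    using u v x by (subst plus_cmp[symmetric]) auto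
  also have "Cmp C (\<delta> [x] (u @ v)) \<dots>
      = Cmp C (Cmp C (\<delta> [x] (u @ v)) (PlusM C (Idm C (K [x])) (\<delta> u v))) (PlusM C (\<tau> x) (PlusM C (sm u) (sm v)))"
    using u v x by (intro cmp_assoc) auto
  also have "\<dots> = Cmp C (Cmp C (\<delta> (x # u) v) (PlusM C (\<delta> [x] u) (Idm C (K v)))) (PlusM C (\<tau> x) (PlusM C (sm u) (sm v)))"
    using \<delta>_assoc[of "[x]" u v] u v x by simp
  also have "\<dots> = Cmp C (\<delta> (x # u) v) (Cmp C (PlusM C (\<delta> [x] u) (Idm C (K v))) (PlusM C (PlusM C (\<tau> x) (sm u)) (sm v)))"
    using u v x by (subst cmp_assoc[symmetric]) (auto simp: plus_assoc plusM_assoc)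
  also have "Cmp C (PlusM C (\<delta> [x] u) (Idm C (K v))) (PlusM C (PlusM C (\<tau> x) (sm u)) (sm v))
      = PlusM C (sm (x # u)) (sm v)"
    using u v x by (subst plus_cmp[symmetric]) auto
  finally show ?case .
qed

end

section \<open>The functor \<open>\<Phi>\<close>\<close>

lemma free_pres_simps [simp]:
  "Atoms (free_pres X) = Ob X" "Gens (free_pres X) = Mor X"
  "gdom (free_pres X) = (\<lambda>f. [Dom X f])" "gcod (free_pres X) = (\<lambda>f. [Cod X f])"
  "Rels (free_pres X) = free_rels X"
  by (simp_all add: free_pres_def)

lemma well_formed_free: "category X \<Longrightarrow> well_formed (free_pres X)" for X :: "('o, 'm) cat"
  by unfold_locales (auto simp: free_pres_def category.dom_ob category.cod_ob)

locale free_permutative = X: category X for X :: "('o, 'm) cat"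
begin

sublocale well_formed "free_pres X" by (rule well_formed_free) unfold_locales

abbreviation PX where "PX \<equiv> presented (free_pres X)"

lemmas Dom_lists [simp] = dom_ob[unfolded Ob_presented free_pres_simps]
  and Cod_lists [simp] = cod_ob[unfolded Ob_presented free_pres_simps]

lemma gen_cmp:
  "\<lbrakk>f \<in> Mor X; g \<in> Mor X; Dom X g = Cod X f\<rbrakk> \<Longrightarrow> gen (Cmp X g f) = Cmp PX (gen g) (gen f)"
  using relation[of "GenT (Cmp X g f)" "CmpT (GenT g) (GenT f)"]
  by (simp add: free_rels.intros X.cmp_mor X.cmp_dom X.cmp_cod)

lemma gen_id: "x \<in> Ob X \<Longrightarrow> gen (Idm X x) = Idm PX [x]"
  using relation[of "GenT (Idm X x)" "IdT [x]"]
  by (simp add: free_rels.intros X.id_mor X.id_dom X.id_cod ev_ob_presented)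

end


lemma category_prod: "category X \<Longrightarrow> category Y \<Longrightarrow> category (prod_cat X Y)"
  for X :: "('o, 'm) cat" and Y :: "('p, 'n) cat"
proof -
  assume "category X" "category Y"
  then interpret X: category X + Y: category Y .
  show ?thesis
    by unfold_locales
      (auto simp: prod_cat_def X.dom_ob X.cod_ob X.id_mor X.id_dom X.id_cod X.cmp_mor X.cmp_dom X.cmp_cod
        X.cmp_id_left X.cmp_id_right X.cmp_assoc Y.dom_ob Y.cod_ob Y.id_mor Y.id_dom Y.id_cod
        Y.cmp_mor Y.cmp_dom Y.cmp_cod Y.cmp_id_left Y.cmp_id_right Y.cmp_assoc)
qed

lemma product_append: "List.product (u @ v) w = List.product u w @ List.product v w"
  by (induction u) auto

lemma product_Nil: "List.product u [] = []"
  by (induction u) auto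

locale free_pair = X: category X + Y: category Y
  for X :: "('o, 'm) cat" and Y :: "('p, 'n) cat"
begin

sublocale PX: free_permutative X by unfold_locales
sublocale PY: free_permutative Y by unfold_locales
sublocale XY: category "prod_cat X Y" by (intro category_prod) unfold_locales
sublocale PXY: free_permutative "prod_cat X Y" by unfold_locales
sublocale tensor_pair PX.PX PY.PX by unfold_locales

lemma prod_cat_simps [simp]:
  "Ob (prod_cat X Y) = Ob X \<times> Ob Y" "Mor (prod_cat X Y) = Mor X \<times> Mor Y"
  "Dom (prod_cat X Y) = map_prod (Dom X) (Dom Y)" "Cod (prod_cat X Y) = map_prod (Cod X) (Cod Y)"
  "Idm (prod_cat X Y) = map_prod (Idm X) (Idm Y)"
  "Cmp (prod_cat X Y) g f = (Cmp X (fst g) (fst f), Cmp Y (snd g) (snd f))"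
  by (simp_all add: prod_cat_def)

lemmas [simp] = X.dom_ob X.cod_ob X.id_mor X.id_dom X.id_cod Y.dom_ob Y.cod_ob Y.id_mor Y.id_dom Y.id_cod

abbreviation D where "D \<equiv> PXY.PX"

abbreviation cmp' (infixr "\<bullet>" 60) where "g \<bullet> f \<equiv> Cmp AB g f"

abbreviation plus' (infixr "\<oplus>" 65) where "f \<oplus> g \<equiv> PlusM AB f g"

abbreviation "psi_ob \<equiv> \<lambda>(x, y). [([x], [y])]"
abbreviation "psi_gen \<equiv> \<lambda>(f, g). gen (Ten (PX.gen f) (PY.gen g))"
abbreviation "Psi \<equiv> extend AB psi_ob psi_gen"

lemma ev_ob_psi: "ev_ob AB psi_ob u = map (\<lambda>(x, y). ([x], [y])) u"
  by (induction u) (auto simp: ev_ob_def)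

sublocale psi: term_model "free_pres (prod_cat X Y)" AB psi_ob psi_gen
  by unfold_locales (auto simp: ev_ob_psi)

lemma psi_respects:
  assumes "Rels (free_pres (prod_cat X Y)) s t"
  shows "ev AB psi_ob psi_gen s = ev AB psi_ob psi_gen t"
proof -
  have "free_rels (prod_cat X Y) s t" using assms by simp
  then show ?thesis
    by cases (auto simp: PX.gen_cmp PY.gen_cmp ten_cmp PX.gen_id PY.gen_id ten_id ev_ob_psi)
qed

sublocale Psi: strict_functor D AB Psi
  by (rule psi.strict_functor_extend) (rule psi_respects)

lemma Fo_Psi [simp]: "Fo Psi u = map (\<lambda>(x, y). ([x], [y])) u"
  by (simp add: extend_def ev_ob_psi)

lemma Fm_Psi_gen [simp]:
  "\<lbrakk>f \<in> Mor X; g \<in> Mor Y\<rbrakk> \<Longrightarrow> Fm Psi (PXY.gen (f, g)) = gen (Ten (PX.gen f) (PY.gen g))"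
  using psi.Fm_extend_gen[OF psi_respects, of "(f, g)"] by simp

text \<open>\<open>row x ys\<close> is the canonical morphism \<open>\<Sum>\<^sub>j [x].[y\<^sub>j] \<rightarrow> [x].ys\<close>, and \<open>grid ys xs\<close> is the canonical
  morphism \<open>\<Sum>\<^sub>i\<Sum>\<^sub>j [x\<^sub>i].[y\<^sub>j] \<rightarrow> xs.ys\<close>.\<close>

abbreviation row where
  "row x \<equiv> lax_sum AB (\<lambda>u v. gen (DL [x] u v)) (gen (ZL [x])) (\<lambda>y. Idm AB [([x], [y])])"

abbreviation grid where
  "grid ys \<equiv> lax_sum AB (\<lambda>u v. gen (DR ys u v)) (gen (ZR ys)) (\<lambda>x. row x ys)"

lemma row_lax:
  assumes "x \<in> Ob X"
  shows "lax_monoidal AB (Ob Y) (\<lambda>u. [([x], u)]) (\<lambda>u v. gen (DL [x] u v)) (gen (ZL [x]))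
    (\<lambda>y. Idm AB [([x], [y])])"
proof unfold_locales
  show "split_epi (gen (ZL [x]))" using assms by (intro inverse_pair_epi[OF zl_inverse]) simp
  show "split_epi (gen (DL [x] u v))" if "u \<in> lists (Ob Y)" "v \<in> lists (Ob Y)" for u v
    using assms that by (intro inverse_pair_epi[OF dl_inverse]) auto
qed (use assms dl_assoc[of "[x]"] dl_unit_left[of "[x]"] in \<open>auto simp: split_epi_id\<close>)

lemma row_simps [simp]:
  assumes "x \<in> Ob X" "u \<in> lists (Ob Y)"
  shows "split_epi (row x u)" "row x u \<in> Mor AB" "Cod AB (row x u) = [([x], u)]"
    "Dom AB (row x u) = map (\<lambda>y. ([x], [y])) u"
proof -
  interpret lax_monoidal AB "Ob Y" "\<lambda>u. [([x], u)]" "\<lambda>u v. gen (DL [x] u v)" "gen (ZL [x])"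
    "\<lambda>y. Idm AB [([x], [y])]"
    using assms by (intro row_lax)
  show *: "split_epi (row x u)" "row x u \<in> Mor AB" "Cod AB (row x u) = [([x], u)]"
    using assms(2) by (rule lax_sum_epi lax_sum_mor lax_sum_cod)+
  show "Dom AB (row x u) = map (\<lambda>y. ([x], [y])) u"
    using assms(2)
  proof (induction u)
    case (Cons y u)
    then show ?case using assms(1) lax_sum_mor[of u] lax_sum_cod[of u] by simp
  qed (use assms(1) in simp)
qed

lemma row_append:
  assumes "x \<in> Ob X" "u \<in> lists (Ob Y)" "v \<in> lists (Ob Y)"
  shows "row x (u @ v) = gen (DL [x] u v) \<bullet> (row x u \<oplus> row x v)"
  using lax_monoidal.lax_sum_append[OF row_lax] assms by blast

text \<open>Right unity absorbs the \<open>ZL\<close> that the fold leaves at the end. Generators of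
  a free permutative category have one-element sources and targets, so this is the form met in the
  generator condition of \<open>comparison\<close>.\<close>

lemma row_singleton:
  assumes "x \<in> Ob X" "y \<in> Ob Y"
  shows "row x [y] = Idm AB [([x], [y])]"
  using assms dl_unit_right[of "[x]" "[y]"] by simp

lemma grid_lax:
  assumes "ys \<in> lists (Ob Y)"
  shows "lax_monoidal AB (Ob X) (\<lambda>u. [(u, ys)]) (\<lambda>u v. gen (DR ys u v)) (gen (ZR ys)) (\<lambda>x. row x ys)"
proof unfold_locales
  show "split_epi (gen (ZR ys))" using assms by (intro inverse_pair_epi[OF zr_inverse]) simp
  show "split_epi (gen (DR ys u v))" if "u \<in> lists (Ob X)" "v \<in> lists (Ob X)" for u v
    using assms that by (intro inverse_pair_epi[OF dr_inverse]) auto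
qed (use assms dr_assoc[of ys] dr_unit_left[of ys] in auto)

lemma grid_simps [simp]:
  assumes "u \<in> lists (Ob X)" "ys \<in> lists (Ob Y)"
  shows "split_epi (grid ys u)" "grid ys u \<in> Mor AB" "Cod AB (grid ys u) = [(u, ys)]"
    "Dom AB (grid ys u) = map (\<lambda>(x, y). ([x], [y])) (List.product u ys)"
proof -
  interpret lax_monoidal AB "Ob X" "\<lambda>u. [(u, ys)]" "\<lambda>u v. gen (DR ys u v)" "gen (ZR ys)"
    "\<lambda>x. row x ys"
    using assms by (intro grid_lax)
  show "split_epi (grid ys u)" "grid ys u \<in> Mor AB" "Cod AB (grid ys u) = [(u, ys)]"
    using assms(1) by (rule lax_sum_epi lax_sum_mor lax_sum_cod)+
  show "Dom AB (grid ys u) = map (\<lambda>(x, y). ([x], [y])) (List.product u ys)"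
    using assms(1)
  proof (induction u)
    case (Cons x u)
    then show ?case using assms(2) lax_sum_mor[of u] lax_sum_cod[of u] by (simp add: comp_def)
  qed (use assms(2) in simp)
qed

lemma grid_append:
  assumes "u \<in> lists (Ob X)" "v \<in> lists (Ob X)" "ys \<in> lists (Ob Y)"
  shows "grid ys (u @ v) = gen (DR ys u v) \<bullet> (grid ys u \<oplus> grid ys v)"
  using lax_monoidal.lax_sum_append[OF grid_lax] assms by blast

text \<open>Right unity of \<open>DR\<close> absorbs the trailing \<open>ZR\<close>, once the sum is
  factored so that the row acts first.\<close>

lemma grid_singleton:
  assumes "x \<in> Ob X" "ys \<in> lists (Ob Y)"
  shows "grid ys [x] = row x ys"
proof -
  have "row x ys \<oplus> gen (ZR ys) = (Idm AB [([x], ys)] \<oplus> gen (ZR ys)) \<bullet> (row x ys \<oplus> Idm AB [])"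
    using assms by (subst plus_cmp[symmetric]) auto
  then show ?thesis
    using assms dr_unit_right[of ys "[x]"] by (simp add: cmp_assoc)
qed

section \<open>Naturality of rows and grids for morphisms \<open>f.g\<close>\<close>

abbreviation left_ob where "left_ob ys \<equiv> \<lambda>x. map (Pair x) ys"

abbreviation left_gen where
  "left_gen ys \<equiv> \<lambda>h. sumM D (map (\<lambda>y. PXY.gen (h, Idm Y y)) ys)"

lemma ev_ob_left [simp]: "ev_ob D (left_ob ys) u = List.product u ys"
  by (induction u) (auto simp: ev_ob_def)

lemma left_gen_simps [simp]:
  assumes "h \<in> Mor X" "ys \<in> lists (Ob Y)"
  shows "left_gen ys h \<in> Mor D" "Dom D (left_gen ys h) = map (Pair (Dom X h)) ys"
    "Cod D (left_gen ys h) = map (Pair (Cod X h)) ys"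
proof -
  have "left_gen ys h \<in> Mor D \<and> Dom D (left_gen ys h) = map (Pair (Dom X h)) ys
    \<and> Cod D (left_gen ys h) = map (Pair (Cod X h)) ys"
    using assms(2) by (induction ys) (use assms(1) in \<open>auto simp: sumM_simps\<close>)
  then show "left_gen ys h \<in> Mor D" "Dom D (left_gen ys h) = map (Pair (Dom X h)) ys"
    "Cod D (left_gen ys h) = map (Pair (Cod X h)) ys" by auto
qed

lemma left_model:
  "ys \<in> lists (Ob Y) \<Longrightarrow> term_model (free_pres X) D (left_ob ys) (left_gen ys)"
  by unfold_locales auto

text \<open>Naturality of \<open>DL\<close> peels off the first column, and the empty row is
  naturality of \<open>ZL\<close>. The result is the generator condition for comparing the functor
  \<open>(-).ys\<close>.\<close>

lemma left_gen_natural: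
  assumes h: "h \<in> Mor X" and "ys \<in> lists (Ob Y)"
  shows "gen (Ten (PX.gen h) (Idm PY.PX ys)) \<bullet> row (Dom X h) ys
    = row (Cod X h) ys \<bullet> Fm Psi (left_gen ys h)"
  using assms(2)
proof (induction ys)
  case Nil
  then show ?case using h zl_nat[of "PX.gen h"] by (simp add: sumM_simps)
next
  case (Cons y ys)
  then have ys: "y \<in> Ob Y" "ys \<in> lists (Ob Y)" by auto
  let ?x = "Dom X h" and ?x' = "Cod X h"
  let ?T = "\<lambda>u. gen (Ten (PX.gen h) (Idm PY.PX u))"
  have T: "?T (y # ys) \<bullet> gen (DL [?x] [y] ys) = gen (DL [?x'] [y] ys) \<bullet> (?T [y] \<oplus> ?T ys)"
    using dl_nat[of "PX.gen h" "Idm PY.PX [y]" "Idm PY.PX ys" "[?x]" "[y]" ys] h ys by simp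
  have "?T (y # ys) \<bullet> gen (DL [?x] [y] ys) \<bullet> (Idm AB [([?x], [y])] \<oplus> row ?x ys)
      = (?T (y # ys) \<bullet> gen (DL [?x] [y] ys)) \<bullet> (Idm AB [([?x], [y])] \<oplus> row ?x ys)"
    using h ys by (intro cmp_assoc) auto
  also have "\<dots> = gen (DL [?x'] [y] ys) \<bullet> (?T [y] \<oplus> ?T ys) \<bullet> (Idm AB [([?x], [y])] \<oplus> row ?x ys)"
    unfolding T using h ys by (intro cmp_assoc[symmetric]) auto
  also have "(?T [y] \<oplus> ?T ys) \<bullet> (Idm AB [([?x], [y])] \<oplus> row ?x ys)
      = ?T [y] \<oplus> (row ?x' ys \<bullet> Fm Psi (left_gen ys h))"
    using h ys Cons by (subst plus_cmp[symmetric]) auto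
  also have "\<dots> = (Idm AB [([?x'], [y])] \<oplus> row ?x' ys) \<bullet> (?T [y] \<oplus> Fm Psi (left_gen ys h))"
    using h ys by (subst plus_cmp[symmetric]) (auto simp: comp_def)
  finally show ?case
    using h ys by (simp add: sumM_simps PY.gen_id cmp_assoc comp_def)
qed

text \<open>An instance of \<open>comparison\<close> for the functor \<open>(-).ys\<close> with
  constraint \<open>DR ys\<close>, whose naturality and symmetry are tensor relations;
  \<open>grid_append\<close> is the monoidality of the grid. It speaks of terms because
  \<open>Phi_left\<close> evaluates a representative.\<close>

lemma left_natural:
  assumes ys: "ys \<in> lists (Ob Y)" and t: "wft (free_pres X) t"
  shows "gen (Ten (cls (free_pres X) t) (Idm PY.PX ys)) \<bullet> grid ys (tdom (free_pres X) t)
    = grid ys (tcod (free_pres X) t) \<bullet> Fm Psi (ev D (left_ob ys) (left_gen ys) t)"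
proof -
  interpret term_model "free_pres X" D "left_ob ys" "left_gen ys" using ys by (rule left_model)
  have "comparison (free_pres X) D (left_ob ys) (left_gen ys) AB Psi (\<lambda>u. [(u, ys)])
    (\<lambda>c. gen (Ten c (Idm PY.PX ys))) (\<lambda>u v. gen (DR ys u v)) (grid ys)"
  proof unfold_locales
    show "gen (Ten (Idm PX.PX u) (Idm PY.PX ys)) = Idm AB [(u, ys)]"
      if "u \<in> lists (Atoms (free_pres X))" for u
      using that ys by (simp add: ten_id)
    show "gen (Ten (Cmp PX.PX d c) (Idm PY.PX ys))
        = gen (Ten d (Idm PY.PX ys)) \<bullet> gen (Ten c (Idm PY.PX ys))"
      if "c \<in> Mor PX.PX" "d \<in> Mor PX.PX" "Dom PX.PX d = Cod PX.PX c" for c d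
      using that ys by (simp add: ten_cmp[symmetric])
  qed (use ys in \<open>simp_all add: dr_nat dr_sym grid_append grid_singleton left_gen_natural
      del: lax_sum.simps\<close>)
  from comparison.natural_term[OF this t] show ?thesis .
qed

abbreviation right_ob where "right_ob x \<equiv> \<lambda>y. [(x, y)]"

abbreviation right_gen where "right_gen x \<equiv> \<lambda>h. PXY.gen (Idm X x, h)"

lemma ev_ob_right [simp]: "ev_ob D (right_ob x) u = map (Pair x) u"
  by (induction u) (auto simp: ev_ob_def)

lemma right_model: "x \<in> Ob X \<Longrightarrow> term_model (free_pres Y) D (right_ob x) (right_gen x)"
  by unfold_locales auto

text \<open>The comparison for the functor \<open>[x].(-)\<close> with constraint
  \<open>DL [x]\<close>, rows taking the place of grids. It treats one summand of
  \<open>Phi_right\<close>.\<close>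

lemma right_natural:
  assumes x: "x \<in> Ob X" and t: "wft (free_pres Y) t"
  shows "gen (Ten (Idm PX.PX [x]) (cls (free_pres Y) t)) \<bullet> row x (tdom (free_pres Y) t)
    = row x (tcod (free_pres Y) t) \<bullet> Fm Psi (ev D (right_ob x) (right_gen x) t)"
proof -
  interpret term_model "free_pres Y" D "right_ob x" "right_gen x" using x by (rule right_model)
  have "comparison (free_pres Y) D (right_ob x) (right_gen x) AB Psi (\<lambda>u. [([x], u)])
    (\<lambda>c. gen (Ten (Idm PX.PX [x]) c)) (\<lambda>u v. gen (DL [x] u v)) (row x)"
  proof unfold_locales
    show "gen (Ten (Idm PX.PX [x]) (Idm PY.PX u)) = Idm AB [([x], u)]"
      if "u \<in> lists (Atoms (free_pres Y))" for u
      using that x by (simp add: ten_id)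
    show "gen (Ten (Idm PX.PX [x]) (Cmp PY.PX d c))
        = gen (Ten (Idm PX.PX [x]) d) \<bullet> gen (Ten (Idm PX.PX [x]) c)"
      if "c \<in> Mor PY.PX" "d \<in> Mor PY.PX" "Dom PY.PX d = Cod PY.PX c" for c d
      using that x by (simp add: ten_cmp[symmetric])
  qed (use x in \<open>simp_all add: dl_nat dl_sym row_append row_singleton PX.gen_id comp_def
      del: lax_sum.simps\<close>)
  from comparison.natural_term[OF this t] show ?thesis .
qed

lemma rep_simps [simp]:
  "c \<in> Mor PX.PX \<Longrightarrow> wft (free_pres X) (rep c)" "c \<in> Mor PX.PX \<Longrightarrow> cls (free_pres X) (rep c) = c"
  "c \<in> Mor PX.PX \<Longrightarrow> tdom (free_pres X) (rep c) = Dom PX.PX c"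
  "c \<in> Mor PX.PX \<Longrightarrow> tcod (free_pres X) (rep c) = Cod PX.PX c"
  "e \<in> Mor PY.PX \<Longrightarrow> wft (free_pres Y) (rep e)" "e \<in> Mor PY.PX \<Longrightarrow> cls (free_pres Y) (rep e) = e"
  "e \<in> Mor PY.PX \<Longrightarrow> tdom (free_pres Y) (rep e) = Dom PY.PX e"
  "e \<in> Mor PY.PX \<Longrightarrow> tcod (free_pres Y) (rep e) = Cod PY.PX e"
  by (auto elim!: PX.Mor_presentedE PY.Mor_presentedE
      simp: PX.rep_typing PX.cls_rep PY.rep_typing PY.cls_rep)

lemma Phi_left_eq: "Phi_left X Y f ys = ev D (left_ob ys) (left_gen ys) (rep f)"
  by (simp add: Phi_left_def FreeP_def extend_def incl_def PXY.gen_def)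

lemma Phi_left_simps [simp]:
  assumes "f \<in> Mor PX.PX" "ys \<in> lists (Ob Y)"
  shows "Phi_left X Y f ys \<in> Mor D" "Dom D (Phi_left X Y f ys) = List.product (Dom PX.PX f) ys"
    "Cod D (Phi_left X Y f ys) = List.product (Cod PX.PX f) ys"
  using term_model.ev_simps[OF left_model[OF assms(2)], of "rep f"] assms
  by (simp_all add: Phi_left_eq)

lemma Phi_left_natural:
  assumes "f \<in> Mor PX.PX" "ys \<in> lists (Ob Y)"
  shows "gen (Ten f (Idm PY.PX ys)) \<bullet> grid ys (Dom PX.PX f)
    = grid ys (Cod PX.PX f) \<bullet> Fm Psi (Phi_left X Y f ys)"
  using left_natural[OF assms(2), of "rep f"] assms by (simp add: Phi_left_eq)

abbreviation Phi_right1 where "Phi_right1 g x \<equiv> ev D (right_ob x) (right_gen x) (rep g)"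

lemma Phi_right_eq: "Phi_right X Y xs g = sumM D (map (Phi_right1 g) xs)"
  by (simp add: Phi_right_def FreeP_def extend_def incl_def PXY.gen_def)

lemma Phi_right1_simps [simp]:
  assumes "g \<in> Mor PY.PX" "x \<in> Ob X"
  shows "Phi_right1 g x \<in> Mor D" "Dom D (Phi_right1 g x) = map (Pair x) (Dom PY.PX g)"
    "Cod D (Phi_right1 g x) = map (Pair x) (Cod PY.PX g)"
  using term_model.ev_simps[OF right_model[OF assms(2)], of "rep g"] assms
  by simp_all

lemma Phi_right_simps [simp]:
  assumes "g \<in> Mor PY.PX" "xs \<in> lists (Ob X)"
  shows "Phi_right X Y xs g \<in> Mor D" "Dom D (Phi_right X Y xs g) = List.product xs (Dom PY.PX g)"
    "Cod D (Phi_right X Y xs g) = List.product xs (Cod PY.PX g)"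
proof -
  have "Phi_right X Y xs g \<in> Mor D \<and> Dom D (Phi_right X Y xs g) = List.product xs (Dom PY.PX g)
    \<and> Cod D (Phi_right X Y xs g) = List.product xs (Cod PY.PX g)"
    unfolding Phi_right_eq
    using assms(2) by (induction xs) (use assms(1) in \<open>auto simp: sumM_simps\<close>)
  then show "Phi_right X Y xs g \<in> Mor D" "Dom D (Phi_right X Y xs g) = List.product xs (Dom PY.PX g)"
    "Cod D (Phi_right X Y xs g) = List.product xs (Cod PY.PX g)" by auto
qed

text \<open>\<open>List.product\<close> runs through \<open>xs\<close> outermost, so
  \<open>g\<close> acts inside each row and \<open>Phi_right\<close> is a sum of evaluations instead
  of one. Naturality of \<open>DR\<close> separates the rows, \<open>right_natural\<close> treats
  each row, and naturality of \<open>ZR\<close> is the empty case.\<close>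

lemma Phi_right_natural:
  assumes g: "g \<in> Mor PY.PX" and "xs \<in> lists (Ob X)"
  shows "gen (Ten (Idm PX.PX xs) g) \<bullet> grid (Dom PY.PX g) xs
    = grid (Cod PY.PX g) xs \<bullet> Fm Psi (Phi_right X Y xs g)"
  using assms(2)
proof (induction xs)
  case Nil
  then show ?case using g zr_nat[of g] by (simp add: Phi_right_eq sumM_simps)
next
  case (Cons x xs)
  then have x: "x \<in> Ob X" "xs \<in> lists (Ob X)" by auto
  let ?y = "Dom PY.PX g" and ?y' = "Cod PY.PX g"
  have y: "?y \<in> lists (Ob Y)" "?y' \<in> lists (Ob Y)"
    using g by simp_all
  let ?T = "\<lambda>u. gen (Ten (Idm PX.PX u) g)"
  have P: "Phi_right X Y (x # xs) g = PlusM D (Phi_right1 g x) (Phi_right X Y xs g)"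
    by (simp add: Phi_right_eq sumM_simps)
  have T: "?T (x # xs) \<bullet> gen (DR ?y [x] xs) = gen (DR ?y' [x] xs) \<bullet> (?T [x] \<oplus> ?T xs)"
    using dr_nat[of g "Idm PX.PX [x]" "Idm PX.PX xs" ?y "[x]" xs] g x by simp
  have N: "?T [x] \<bullet> row x ?y = row x ?y' \<bullet> Fm Psi (Phi_right1 g x)"
    using right_natural[OF x(1), of "rep g"] g by simp
  have "?T (x # xs) \<bullet> gen (DR ?y [x] xs) \<bullet> (row x ?y \<oplus> grid ?y xs)
      = (?T (x # xs) \<bullet> gen (DR ?y [x] xs)) \<bullet> (row x ?y \<oplus> grid ?y xs)"
    using g x y by (intro cmp_assoc) auto
  also have "\<dots> = gen (DR ?y' [x] xs) \<bullet> (?T [x] \<oplus> ?T xs) \<bullet> (row x ?y \<oplus> grid ?y xs)"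
    unfolding T using g x y by (intro cmp_assoc[symmetric]) (auto simp: comp_def)
  also have "(?T [x] \<oplus> ?T xs) \<bullet> (row x ?y \<oplus> grid ?y xs)
      = (row x ?y' \<bullet> Fm Psi (Phi_right1 g x)) \<oplus> (grid ?y' xs \<bullet> Fm Psi (Phi_right X Y xs g))"
    using g x y Cons N by (subst plus_cmp[symmetric]) auto
  also have "\<dots> = (row x ?y' \<oplus> grid ?y' xs) \<bullet> (Fm Psi (Phi_right1 g x) \<oplus> Fm Psi (Phi_right X Y xs g))"
    using g x y by (intro plus_cmp) (auto simp: comp_def)
  finally show ?case
    using g x y by (simp add: P cmp_assoc comp_def)
qed

text \<open>The factorisation of \<open>f.g\<close> as \<open>1.g\<close> followed by
  \<open>f.1\<close> has the same order as the composite defining \<open>Phi_gen\<close> on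
  \<open>Ten\<close>, so the squares of the two factors paste.\<close>

lemma Ten_natural:
  assumes f: "f \<in> Mor PX.PX" and g: "g \<in> Mor PY.PX"
  shows "gen (Ten f g) \<bullet> grid (Dom PY.PX g) (Dom PX.PX f)
    = grid (Cod PY.PX g) (Cod PX.PX f) \<bullet> Fm Psi (Phi_gen X Y (Ten f g))"
proof -
  let ?x = "Dom PX.PX f" and ?x' = "Cod PX.PX f" and ?y = "Dom PY.PX g" and ?y' = "Cod PY.PX g"
  have xy: "?x \<in> lists (Ob X)" "?x' \<in> lists (Ob X)" "?y \<in> lists (Ob Y)" "?y' \<in> lists (Ob Y)"
    using f g by simp_all
  have "gen (Ten f g) = gen (Ten f (Idm PY.PX ?y')) \<bullet> gen (Ten (Idm PX.PX ?x) g)"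
    using f g xy by (simp add: ten_cmp[symmetric])
  then have "gen (Ten f g) \<bullet> grid ?y ?x
      = gen (Ten f (Idm PY.PX ?y')) \<bullet> gen (Ten (Idm PX.PX ?x) g) \<bullet> grid ?y ?x"
    using f g xy by (simp add: cmp_assoc)
  also have "\<dots> = gen (Ten f (Idm PY.PX ?y')) \<bullet> grid ?y' ?x \<bullet> Fm Psi (Phi_right X Y ?x g)"
    using f g xy by (simp add: Phi_right_natural)
  also have "\<dots> = (gen (Ten f (Idm PY.PX ?y')) \<bullet> grid ?y' ?x) \<bullet> Fm Psi (Phi_right X Y ?x g)"
    using f g xy by (intro cmp_assoc) auto
  also have "\<dots> = (grid ?y' ?x' \<bullet> Fm Psi (Phi_left X Y f ?y')) \<bullet> Fm Psi (Phi_right X Y ?x g)"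
    using f xy by (simp add: Phi_left_natural)
  finally show ?thesis
    using f g xy by (simp add: cmp_assoc FreeP_def)
qed

text \<open>The symmetry in one step of the recursion of \<open>Phi_delta\<close>. It has the shape
  of the middle symmetry in \<open>dl_dr\<close> for \<open>a = [x]\<close> and
  \<open>a' = xs\<close>, with every product expanded into its pairs.\<close>

definition delta_swap where
  "delta_swap x xs ys ys' = PlusM D (Idm D (map (Pair x) ys))
     (PlusM D (Beta D (List.product xs ys) (map (Pair x) ys')) (Idm D (List.product xs ys')))"

lemma Phi_delta_Cons:
  "Phi_delta X Y (x # xs) ys ys' = Cmp D
     (PlusM D (Idm D (map (Pair x) (ys @ ys'))) (Phi_delta X Y xs ys ys')) (delta_swap x xs ys ys')"
  by (simp add: FreeP_def Let_def delta_swap_def)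

lemma pairs_atoms [simp]:
  "\<lbrakk>x \<in> Ob X; ys \<in> lists (Ob Y)\<rbrakk> \<Longrightarrow> map (Pair x) ys \<in> lists (Ob X \<times> Ob Y)"
  "\<lbrakk>xs \<in> lists (Ob X); ys \<in> lists (Ob Y)\<rbrakk> \<Longrightarrow> List.product xs ys \<in> lists (Ob X \<times> Ob Y)"
  by auto

lemma delta_swap_inverse:
  assumes "x \<in> Ob X" "xs \<in> lists (Ob X)" "ys \<in> lists (Ob Y)" "ys' \<in> lists (Ob Y)"
  shows "\<exists>g. PXY.inverse_pair (delta_swap x xs ys ys') g"
proof
  show "PXY.inverse_pair (delta_swap x xs ys ys') (PlusM D (Idm D (map (Pair x) ys))
     (PlusM D (Beta D (map (Pair x) ys') (List.product xs ys)) (Idm D (List.product xs ys'))))"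
    unfolding delta_swap_def
    by (intro PXY.inverse_pair_plus PXY.inverse_pair_beta PXY.inverse_pair_id) (use assms in auto)
qed

lemma delta_swap_simps [simp]:
  assumes "x \<in> Ob X" "xs \<in> lists (Ob X)" "ys \<in> lists (Ob Y)" "ys' \<in> lists (Ob Y)"
  shows "delta_swap x xs ys ys' \<in> Mor D"
    "Dom D (delta_swap x xs ys ys') = List.product (x # xs) ys @ List.product (x # xs) ys'"
    "Cod D (delta_swap x xs ys ys')
      = map (Pair x) (ys @ ys') @ List.product xs ys @ List.product xs ys'"
  using assms pairs_atoms(1)[OF assms(1,3)] pairs_atoms(1)[OF assms(1,4)]
    pairs_atoms(2)[OF assms(2,3)] pairs_atoms(2)[OF assms(2,4)]
  by (auto simp: delta_swap_def)

text \<open>The value of \<open>Phi_gen\<close> on \<open>DLi\<close> is a definite description and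
  means something only once an inverse exists. Source and target are carried through the induction
  because the recursive composite must be known to be composable.\<close>

lemma Phi_delta_inverse:
  assumes "xs \<in> lists (Ob X)" and ys: "ys \<in> lists (Ob Y)" "ys' \<in> lists (Ob Y)"
  shows "(\<exists>g. PXY.inverse_pair (Phi_delta X Y xs ys ys') g)
    \<and> Dom D (Phi_delta X Y xs ys ys') = List.product xs ys @ List.product xs ys'
    \<and> Cod D (Phi_delta X Y xs ys ys') = List.product xs (ys @ ys')"
  using assms(1)
proof (induction xs)
  case Nil
  have "PXY.inverse_pair (Idm D []) (Idm D [])" by (rule PXY.inverse_pair_id) simp
  then show ?case by (auto simp: FreeP_def)
next
  case (Cons x xs)
  then have x: "x \<in> Ob X" "xs \<in> lists (Ob X)" by auto
  obtain g where g: "PXY.inverse_pair (Phi_delta X Y xs ys ys') g"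
    and Dom: "Dom D (Phi_delta X Y xs ys ys') = List.product xs ys @ List.product xs ys'"
    and Cod: "Cod D (Phi_delta X Y xs ys ys') = List.product xs (ys @ ys')"
    using Cons by auto
  have m: "Phi_delta X Y xs ys ys' \<in> Mor D" using g by (simp add: PXY.inverse_pair_def)
  obtain h where h: "PXY.inverse_pair (delta_swap x xs ys ys') h"
    using delta_swap_inverse[OF x ys] by blast
  have i: "map (Pair x) (ys @ ys') \<in> lists (Ob X \<times> Ob Y)" using x ys by (intro pairs_atoms) auto
  let ?p = "PlusM D (Idm D (map (Pair x) (ys @ ys'))) (Phi_delta X Y xs ys ys')"
  have p: "?p \<in> Mor D" "Dom D ?p = Cod D (delta_swap x xs ys ys')"
      "Cod D ?p = List.product (x # xs) (ys @ ys')"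
    using i m x ys Dom Cod by simp_all
  have "PXY.inverse_pair (Cmp D ?p (delta_swap x xs ys ys'))
      (Cmp D h (PlusM D (Idm D (map (Pair x) (ys @ ys'))) g))"
    by (intro PXY.inverse_pair_cmp[OF h] PXY.inverse_pair_plus PXY.inverse_pair_id g)
      (use i p in simp_all)
  then show ?case
    unfolding Phi_delta_Cons using p x ys by (auto simp del: List.product.simps)
qed

lemma Phi_delta_simps [simp]:
  assumes "xs \<in> lists (Ob X)" "ys \<in> lists (Ob Y)" "ys' \<in> lists (Ob Y)"
  shows "Phi_delta X Y xs ys ys' \<in> Mor D"
    "Dom D (Phi_delta X Y xs ys ys') = List.product xs ys @ List.product xs ys'"
    "Cod D (Phi_delta X Y xs ys ys') = List.product xs (ys @ ys')"
    "PXY.inverse_pair (Phi_delta X Y xs ys ys') (inverse_mor D (Phi_delta X Y xs ys ys'))"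
proof -
  obtain g where "PXY.inverse_pair (Phi_delta X Y xs ys ys') g"
    using Phi_delta_inverse[OF assms] by blast
  then show "PXY.inverse_pair (Phi_delta X Y xs ys ys') (inverse_mor D (Phi_delta X Y xs ys ys'))"
    using PXY.inverse_mor_eq by simp
  then show "Phi_delta X Y xs ys ys' \<in> Mor D" by (simp add: PXY.inverse_pair_def)
qed (use Phi_delta_inverse[OF assms] in auto)

lemma Phi_delta_inverse_simps [simp]:
  assumes "xs \<in> lists (Ob X)" "ys \<in> lists (Ob Y)" "ys' \<in> lists (Ob Y)"
  shows "inverse_mor D (Phi_delta X Y xs ys ys') \<in> Mor D"
    "Dom D (inverse_mor D (Phi_delta X Y xs ys ys')) = List.product xs (ys @ ys')"
    "Cod D (inverse_mor D (Phi_delta X Y xs ys ys')) = List.product xs ys @ List.product xs ys'"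
  using Phi_delta_simps[OF assms] by (simp_all add: PXY.inverse_pair_def)

text \<open>Reading \<open>x # xs\<close> as the sum of \<open>[x]\<close> and \<open>xs\<close>,
  relation \<open>dl_dr\<close> exchanges \<open>DL\<close> after \<open>DR\<close> for
  \<open>DR\<close> after \<open>DL\<close> at the price of one symmetry, and naturality turns that
  symmetry into \<open>delta_swap\<close>. What remains splits into a single row, joined by
  \<open>row_append\<close>, and the shorter grid. For empty \<open>xs\<close> the grids are
  \<open>ZR\<close>, and the claim is \<open>dl_zr\<close>.\<close>

lemma DL_natural:
  assumes "xs \<in> lists (Ob X)" and ys: "ys \<in> lists (Ob Y)" "ys' \<in> lists (Ob Y)"
  shows "gen (DL xs ys ys') \<bullet> (grid ys xs \<oplus> grid ys' xs)
    = grid (ys @ ys') xs \<bullet> Fm Psi (Phi_delta X Y xs ys ys')"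
  using assms(1)
proof (induction xs)
  case Nil
  then show ?case using ys dl_zr[of ys ys'] by (simp add: FreeP_def)
next
  case (Cons x xs)
  then have x: "x \<in> Ob X" "xs \<in> lists (Ob X)" by auto
  let ?l = "row x ys" and ?l' = "row x ys'" and ?t = "grid ys xs" and ?t' = "grid ys' xs"
  let ?p = "map (\<lambda>(x, y). ([x], [y])) (List.product xs ys)" and ?q = "map (\<lambda>y. ([x], [y])) ys'"
  let ?dl = "gen (DL [x] ys ys') \<oplus> gen (DL xs ys ys')"
  let ?dr = "gen (DR (ys @ ys') [x] xs)"
  let ?b = "Idm AB [([x], ys)] \<oplus> Beta AB [(xs, ys)] [([x], ys')] \<oplus> Idm AB [(xs, ys')]"
  have sw: "Fm Psi (delta_swap x xs ys ys')
      = Idm AB (map (\<lambda>y. ([x], [y])) ys) \<oplus> Beta AB ?p ?q \<oplus> Idm AB (map (\<lambda>(x, y). ([x], [y])) (List.product xs ys'))"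
    using x ys by (simp add: delta_swap_def comp_def)
  have pq: "map (\<lambda>y. ([x], [y])) ys \<in> lists (lists (Ob X) \<times> lists (Ob Y))"
     "?p \<in> lists (lists (Ob X) \<times> lists (Ob Y))" "?q \<in> lists (lists (Ob X) \<times> lists (Ob Y))"
     "map (\<lambda>(x, y). ([x], [y])) (List.product xs ys') \<in> lists (lists (Ob X) \<times> lists (Ob Y))"
    using x ys by auto
  \<comment> \<open>Moves the symmetry from the collected objects \<open>xs.ys\<close> and
    \<open>[x].ys'\<close> down to the sums of their pairs, where it lies in the image of
    \<open>Psi\<close>.\<close>
  have B: "Beta AB [(xs, ys)] [([x], ys')] \<bullet> (?t \<oplus> ?l') = (?l' \<oplus> ?t) \<bullet> Beta AB ?p ?q"
    using x ys by (intro beta_natural) auto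
  have "gen (DL (x # xs) ys ys') \<bullet> (grid ys (x # xs) \<oplus> grid ys' (x # xs))
      = gen (DL (x # xs) ys ys') \<bullet> (gen (DR ys [x] xs) \<oplus> gen (DR ys' [x] xs)) \<bullet> ((?l \<oplus> ?t) \<oplus> (?l' \<oplus> ?t'))"
    using x ys by (simp add: plus_cmp)
  also have "\<dots> = (gen (DL (x # xs) ys ys') \<bullet> (gen (DR ys [x] xs) \<oplus> gen (DR ys' [x] xs))) \<bullet> ((?l \<oplus> ?t) \<oplus> (?l' \<oplus> ?t'))"
    using x ys by (intro cmp_assoc) auto
  also have "\<dots> = (?dr \<bullet> ?dl \<bullet> ?b) \<bullet> ((?l \<oplus> ?t) \<oplus> (?l' \<oplus> ?t'))"
    using dl_dr[of "[x]" xs ys ys'] x ys by simp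
  also have "\<dots> = ?dr \<bullet> ?dl \<bullet> ?b \<bullet> (?l \<oplus> (?t \<oplus> ?l') \<oplus> ?t')"
    using x ys by (simp add: cmp_assoc[symmetric] plusM_assoc)
  also have "?b \<bullet> (?l \<oplus> (?t \<oplus> ?l') \<oplus> ?t') = ?l \<oplus> ((?l' \<oplus> ?t) \<bullet> Beta AB ?p ?q) \<oplus> ?t'"
    using x ys pq by (simp add: B plus_cmp[symmetric])
  also have "\<dots> = ((?l \<oplus> ?l') \<oplus> (?t \<oplus> ?t')) \<bullet> Fm Psi (delta_swap x xs ys ys')"
  proof -
    have "(?l \<oplus> ?l') \<oplus> (?t \<oplus> ?t') = ?l \<oplus> (?l' \<oplus> ?t) \<oplus> ?t'"
      using x ys by (simp add: plusM_assoc)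
    then show ?thesis using x ys pq by (simp add: sw plus_cmp[symmetric] del: map_append)
  qed
  also have "?dl \<bullet> \<dots> = (row x (ys @ ys') \<oplus> (gen (DL xs ys ys') \<bullet> (?t \<oplus> ?t'))) \<bullet> Fm Psi (delta_swap x xs ys ys')"
  proof -
    have "?dl \<bullet> ((?l \<oplus> ?l') \<oplus> (?t \<oplus> ?t')) \<bullet> Fm Psi (delta_swap x xs ys ys')
       = (?dl \<bullet> ((?l \<oplus> ?l') \<oplus> (?t \<oplus> ?t'))) \<bullet> Fm Psi (delta_swap x xs ys ys')"
      using x ys by (intro cmp_assoc) (auto simp: comp_def)
    also have "?dl \<bullet> ((?l \<oplus> ?l') \<oplus> (?t \<oplus> ?t'))
       = row x (ys @ ys') \<oplus> (gen (DL xs ys ys') \<bullet> (?t \<oplus> ?t'))"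
      using x ys by (simp add: plus_cmp[symmetric] row_append)
    finally show ?thesis .
  qed
  \<comment> \<open>The row contributes an identity and the shorter grid the induction hypothesis;
    their sum is the left factor in the recursion of \<open>Phi_delta\<close>.\<close>
  also have "row x (ys @ ys') \<oplus> (gen (DL xs ys ys') \<bullet> (?t \<oplus> ?t'))
     = (row x (ys @ ys') \<oplus> grid (ys @ ys') xs)
       \<bullet> Fm Psi (PlusM D (Idm D (map (Pair x) (ys @ ys'))) (Phi_delta X Y xs ys ys'))"
    using x ys pq Cons by (simp add: plus_cmp[symmetric] comp_def)
  finally show ?case
    using x ys pq by (simp add: Phi_delta_Cons cmp_assoc comp_def del: Phi_delta.simps)
qed

text \<open>In a grid without columns, \<open>zl_zr\<close> identifies the final
  \<open>ZR []\<close> with \<open>ZL []\<close>, and \<open>dr_zl\<close> absorbs each further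
  \<open>ZL [x]\<close>. Since \<open>Phi\<close> sends \<open>ZL\<close> and \<open>ZLi\<close> to
  identities, this equation settles both generators.\<close>

lemma ZL_natural:
  assumes "xs \<in> lists (Ob X)"
  shows "gen (ZL xs) = grid [] xs"
  using assms
proof (induction xs)
  case Nil
  then show ?case using zl_zr by simp
next
  case (Cons x xs)
  then show ?case using dr_zl[of "[x]" xs] by simp
qed

section \<open>The left equivalence for \<open>Phi\<close>\<close>

abbreviation "prod_ob \<equiv> \<lambda>(xs, ys). List.product xs ys"

lemma ev_ob_Phi [simp]: "ev_ob D prod_ob u = concat (map prod_ob u)"
  by (induction u) (auto simp: ev_ob_def)

text \<open>By \<open>product_append\<close> the source and target of the value on \<open>DR\<close>
  are literally the same list, and \<open>product_Nil\<close> does the same for \<open>ZL\<close>;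
  this is what makes the identities in \<open>Phi_gen\<close> well typed.\<close>

lemma Phi_model: "term_model (tensor_pres PX.PX PY.PX) D prod_ob (Phi_gen X Y)"
proof unfold_locales
  fix g assume "g \<in> Gens (tensor_pres PX.PX PY.PX)"
  then show "Phi_gen X Y g \<in> Mor D" 
    "Dom D (Phi_gen X Y g) = ev_ob D prod_ob (gdom (tensor_pres PX.PX PY.PX) g)"
    "Cod D (Phi_gen X Y g) = ev_ob D prod_ob (gcod (tensor_pres PX.PX PY.PX) g)"
    by (cases g; simp add: FreeP_def product_append product_Nil)+
qed auto

lemma DR_natural:
  assumes "ys \<in> lists (Ob Y)" "xs \<in> lists (Ob X)" "xs' \<in> lists (Ob X)"
  shows "gen (DR ys xs xs') \<bullet> (grid ys xs \<oplus> grid ys xs') = grid ys (xs @ xs')"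
  using assms by (simp add: grid_append)

text \<open>\<open>DLi\<close> is derived from \<open>DL\<close> because \<open>Psi\<close>
  preserves inverses. At \<open>DRi\<close>, \<open>ZLi\<close> and \<open>ZRi\<close> the
  constraint simply cancels, its value under \<open>Phi\<close> being an identity.\<close>

lemma left_equivalence_Phi:
  "left_equivalence (FreeP X \<otimes>\<^sub>P FreeP Y) (FreeP (prod_cat X Y)) (Phi X Y) Psi
    (\<lambda>u. sumM AB (map (\<lambda>(xs, ys). grid ys xs) u))"
proof -
  interpret term_model "tensor_pres PX.PX PY.PX" D prod_ob "Phi_gen X Y" by (rule Phi_model)
  interpret atomwise "tensor_pres PX.PX PY.PX" D prod_ob "Phi_gen X Y" Psi "\<lambda>(xs, ys). grid ys xs"
    by unfold_locales (auto simp: in_lists_conv_set)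
  have "left_equivalence AB D (extend D prod_ob (Phi_gen X Y)) Psi th_sum"
  proof (rule left_equivalence_extend)
    fix g assume g: "g \<in> Gens (tensor_pres PX.PX PY.PX)"
    show "gen g \<bullet> th_sum (gdom (tensor_pres PX.PX PY.PX) g)
      = th_sum (gcod (tensor_pres PX.PX PY.PX) g) \<bullet> Fm Psi (Phi_gen X Y g)"
    proof (cases g)
      case (Ten f f')
      with g show ?thesis using Ten_natural[of f f']
        by (simp add: sumM_simps)
    next
      case (DL xs ys ys')
      with g show ?thesis using DL_natural[of xs ys ys'] by (simp add: sumM_simps)
    next
      case (DLi xs ys ys')
      then have *: "xs \<in> lists (Ob X)" "ys \<in> lists (Ob Y)" "ys' \<in> lists (Ob Y)"
        using g by auto
      have "gen (DLi xs ys ys') \<bullet> grid (ys @ ys') xs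
          = (grid ys xs \<oplus> grid ys' xs) \<bullet> Fm Psi (inverse_mor D (Phi_delta X Y xs ys ys'))"
        by (rule inverse_pair_square[OF dl_inverse Psi.map_inverse_pair])
          (use * DL_natural[of xs ys ys'] in simp_all)
      with DLi * show ?thesis by (simp add: sumM_simps FreeP_def)
    next
      case (DR ys xs xs')
      with g show ?thesis
        by (simp add: sumM_simps FreeP_def DR_natural product_append)
    next
      case (DRi ys xs xs')
      then have *: "xs \<in> lists (Ob X)" "xs' \<in> lists (Ob X)" "ys \<in> lists (Ob Y)"
        using g by auto
      have "gen (DRi ys xs xs') \<bullet> grid ys (xs @ xs')
          = (gen (DRi ys xs xs') \<bullet> gen (DR ys xs xs')) \<bullet> (grid ys xs \<oplus> grid ys xs')"
        unfolding DR_natural[OF *(3,1,2), symmetric] using * by (intro cmp_assoc) auto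
      also have "\<dots> = grid ys xs \<oplus> grid ys xs'"
        using * by (simp add: inverse_cmp[OF dr_inverse])
      finally have "gen (DRi ys xs xs') \<bullet> grid ys (xs @ xs') = grid ys xs \<oplus> grid ys xs'" .
      with DRi * show ?thesis by (simp add: sumM_simps FreeP_def product_append)
    next
      case (ZL xs)
      with g show ?thesis by (simp add: sumM_simps FreeP_def ZL_natural[symmetric] del: lax_sum.simps)
    next
      case (ZLi xs)
      with g show ?thesis
        by (simp add: sumM_simps FreeP_def ZL_natural[symmetric] inverse_cmp[OF zl_inverse] del: lax_sum.simps)
    next
      case (ZR ys)
      with g show ?thesis by (simp add: sumM_simps FreeP_def)
    next
      case (ZRi ys)
      with g show ?thesis by (simp add: sumM_simps FreeP_def inverse_cmp[OF zr_inverse])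
    qed
  qed
  then show ?thesis by (simp add: Phi_def tensor_def FreeP_def)
qed

end

section \<open>Relabelling and iterated tensors\<close>

locale relabelling = permutative C for C :: "('o, 'm) pcat" +
  fixes p :: "'o \<Rightarrow> 'p" and q :: "'m \<Rightarrow> 'n"
  assumes inj_ob: "inj_on p (Ob C)" and inj_mor: "inj_on q (Mor C)"
begin

abbreviation R where "R \<equiv> relabel p q C"

lemma inverses [simp]:
  "x \<in> Ob C \<Longrightarrow> inv_into (Ob C) p (p x) = x" "f \<in> Mor C \<Longrightarrow> inv_into (Mor C) q (q f) = f"
  using inj_ob inj_mor by (auto simp: inv_into_f_f)

lemma relabel_simps [simp]:
  "Ob R = p ` Ob C" "Mor R = q ` Mor C" "Zero R = p (Zero C)"
  "f \<in> Mor C \<Longrightarrow> Dom R (q f) = p (Dom C f)" "f \<in> Mor C \<Longrightarrow> Cod R (q f) = p (Cod C f)"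
  "x \<in> Ob C \<Longrightarrow> Idm R (p x) = q (Idm C x)"
  "\<lbrakk>f \<in> Mor C; g \<in> Mor C\<rbrakk> \<Longrightarrow> Cmp R (q g) (q f) = q (Cmp C g f)"
  "\<lbrakk>f \<in> Mor C; g \<in> Mor C\<rbrakk> \<Longrightarrow> PlusM R (q g) (q f) = q (PlusM C g f)"
  "\<lbrakk>x \<in> Ob C; y \<in> Ob C\<rbrakk> \<Longrightarrow> Plus R (p x) (p y) = p (Plus C x y)"
  "\<lbrakk>x \<in> Ob C; y \<in> Ob C\<rbrakk> \<Longrightarrow> Beta R (p x) (p y) = q (Beta C x y)"
  by (simp_all add: relabel_def Let_def)

lemma p_eq [simp]: "\<lbrakk>x \<in> Ob C; y \<in> Ob C\<rbrakk> \<Longrightarrow> p x = p y \<longleftrightarrow> x = y"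
  using inj_ob by (auto simp: inj_on_def)

lemma permutative_relabel: "permutative R"
  by unfold_locales
    (simp; (elim imageE)?; simp add: cmp_assoc plus_cmp plus_assoc plusM_assoc beta_natural beta_inv
      beta_plus)+

text \<open>The two renamings are strict and mutually inverse on the carriers, which permits
  identities as components.\<close>

lemma left_equivalence_from_relabel:
  "left_equivalence R C (from_relabel p q C) (to_relabel p q) (Idm R)"
proof -
  interpret R: permutative R by (rule permutative_relabel)
  show ?thesis
    by unfold_locales
      (simp_all add: from_relabel_def to_relabel_def R.split_epi_id, (elim imageE; simp)+)
qed

end

text \<open>Serves the identifications by \<open>TLeaf\<close> and \<open>TPair\<close>. As
  \<open>p'\<close> and \<open>q'\<close> are left inverses of \<open>p\<close> and
  \<open>q\<close>, going forth and back fixes every atom and generator, so identities are natural.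
  Functoriality is asked of \<open>q'\<close>, which induces the strict functor
  \<open>G\<close>.\<close>

lemma left_equivalence_FreeP_map:
  assumes X: "category X" and Y: "category Y"
    and p: "\<And>x. x \<in> Ob X \<Longrightarrow> p x \<in> Ob Y \<and> p' (p x) = x"
    and q: "\<And>f. f \<in> Mor X \<Longrightarrow> q f \<in> Mor Y \<and> Dom Y (q f) = p (Dom X f) \<and> Cod Y (q f) = p (Cod X f)
      \<and> q' (q f) = f"
    and p': "\<And>y. y \<in> Ob Y \<Longrightarrow> p' y \<in> Ob X \<and> q' (Idm Y y) = Idm X (p' y)"
    and q': "\<And>g. g \<in> Mor Y \<Longrightarrow> q' g \<in> Mor X \<and> Dom X (q' g) = p' (Dom Y g) \<and> Cod X (q' g) = p' (Cod Y g)"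
    and q'_cmp: "\<And>f g. \<lbrakk>f \<in> Mor Y; g \<in> Mor Y; Dom Y g = Cod Y f\<rbrakk>
      \<Longrightarrow> q' (Cmp Y g f) = Cmp X (q' g) (q' f)"
  shows "left_equivalence (FreeP X) (FreeP Y) (FreeP_map Y p q) (FreeP_map X p' q')
    (\<lambda>u. sumM (FreeP X) (map (\<lambda>x. Idm (FreeP X) [x]) u))"
proof -
  interpret X: free_permutative X using X by (rule free_permutative.intro)
  interpret Y: free_permutative Y using Y by (rule free_permutative.intro)
  let ?G = "extend X.PX (\<lambda>y. [p' y]) (\<lambda>g. X.gen (q' g))"
  have ev_obX: "ev_ob X.PX (\<lambda>y. [p' y]) u = map p' u" for u
    by (induction u) (auto simp: ev_ob_def)
  have ev_obY: "ev_ob Y.PX (\<lambda>x. [p x]) u = map p u" for u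
    by (induction u) (auto simp: ev_ob_def)
  interpret G: term_model "free_pres Y" X.PX "\<lambda>y. [p' y]" "\<lambda>g. X.gen (q' g)"
    by unfold_locales (use p' q' in \<open>auto simp: ev_obX\<close>)
  have respects: "ev X.PX (\<lambda>y. [p' y]) (\<lambda>g. X.gen (q' g)) s = ev X.PX (\<lambda>y. [p' y]) (\<lambda>g. X.gen (q' g)) t"
    if "Rels (free_pres Y) s t" for s t
  proof -
    have "free_rels Y s t" using that by simp
    then show ?thesis
      by cases (use p' q' in \<open>auto simp: q'_cmp X.gen_cmp X.gen_id ev_obX\<close>)
  qed
  interpret Gs: strict_functor Y.PX X.PX ?G
    by (rule G.strict_functor_extend) (rule respects)
  interpret F: term_model "free_pres X" Y.PX "\<lambda>x. [p x]" "\<lambda>f. Y.gen (q f)"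
    by unfold_locales (use p q in \<open>auto simp: ev_obY\<close>)
  interpret atomwise "free_pres X" Y.PX "\<lambda>x. [p x]" "\<lambda>f. Y.gen (q f)" ?G "\<lambda>x. Idm X.PX [x]"
    by unfold_locales (use p in \<open>auto simp: extend_def ev_obX intro!: X.split_epi_id\<close>)
  have G_gen: "Fm ?G (Y.gen g) = X.gen (q' g)" if "g \<in> Mor Y" for g
    using that respects by (intro G.Fm_extend_gen) auto
  have "left_equivalence X.PX Y.PX (extend Y.PX (\<lambda>x. [p x]) (\<lambda>f. Y.gen (q f))) ?G th_sum"
    by (rule left_equivalence_extend)
      (use q in \<open>auto simp: sumM_simps G_gen X.X.dom_ob X.X.cod_ob\<close>)
  then show ?thesis
    by (simp add: FreeP_map_def FreeP_def incl_def X.gen_def Y.gen_def)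
qed

lemma category_discrete: "category (discrete S)"
  by unfold_locales (auto simp: discrete_def)

text \<open>A class is recovered from its representative as \<open>cls P (rep c)\<close>, so
  distinct morphisms receive distinct names.\<close>

lemma inj_on_node_name: "well_formed P \<Longrightarrow> inj_on node_name (Mor (presented P))"
  by (rule inj_onI)
    (metis node_name_def tmor.inject(2) well_formed.Mor_presentedE well_formed.cls_rep)

text \<open>The induction follows the recursion of \<open>Phi_iter\<close>, composing one left
  equivalence for each factor of its definition. \<open>G\<close> and \<open>\<theta>\<close> stay
  existential, as faithfulness asks only that they exist.\<close>

lemma left_equivalence_Phi_iter:
  "\<exists>G \<theta>. left_equivalence (underlying (Pob Q)) (FreeP (T Q)) (Phi_iter Q) G \<theta>"
proof (induction Q)
  case (Leaf A)
  let ?P = "FreeP (discrete (Ob A))"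
  interpret P: free_permutative "discrete (Ob A)"
    using category_discrete by (rule free_permutative.intro)
  have 1: "left_equivalence (relabel LeafOb LeafMor ?P) ?P (from_relabel LeafOb LeafMor ?P)
      (to_relabel LeafOb LeafMor) (Idm (relabel LeafOb LeafMor ?P))"
    by (rule relabelling.left_equivalence_from_relabel, intro relabelling.intro relabelling_axioms.intro)
      (auto simp: FreeP_def P.permutative_presented inj_on_def)
  \<comment> \<open>The missing case \<open>TPair\<close> never occurs in the carrier of
    \<open>T (Leaf A)\<close>.\<close>
  let ?inv = "\<lambda>t. case t of TLeaf a \<Rightarrow> a"
  have 2: "left_equivalence ?P (FreeP (T (Leaf A))) (FreeP_map (T (Leaf A)) TLeaf TLeaf)
      (FreeP_map (discrete (Ob A)) ?inv ?inv) (\<lambda>u. sumM ?P (map (\<lambda>x. Idm ?P [x]) u))"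
    unfolding T_def
    by (rule left_equivalence_FreeP_map) (auto simp: category_discrete, auto simp: discrete_def)
  show ?case
    using left_equivalence_comp[OF 1 2] by (auto simp del: comp_func_def)
next
  case (Node L R)
  let ?C = "underlying (Pob L) \<otimes>\<^sub>P underlying (Pob R)"
  obtain G G' \<theta> \<theta>' where L: "left_equivalence (underlying (Pob L)) (FreeP (T L)) (Phi_iter L) G \<theta>"
    and R: "left_equivalence (underlying (Pob R)) (FreeP (T R)) (Phi_iter R) G' \<theta>'"
    using Node by auto
  \<comment> \<open>A left equivalence includes the permutativity of its source, so the induction
    hypotheses supply it for both factors.\<close>
  have P: "permutative (underlying (Pob L))" "permutative (underlying (Pob R))"
    using L R unfolding left_equivalence_def graph_map_def by blast+
  interpret tensor_pair "underlying (Pob L)" "underlying (Pob R)" using P by (rule tensor_pair.intro)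
  have 1: "left_equivalence (relabel NodeOb node_name ?C) ?C (from_relabel NodeOb node_name ?C)
      (to_relabel NodeOb node_name) (Idm (relabel NodeOb node_name ?C))"
  proof (rule relabelling.left_equivalence_from_relabel, intro relabelling.intro relabelling_axioms.intro)
    show "permutative ?C" unfolding tensor_def by (rule permutative_presented)
    show "inj_on NodeOb (Ob ?C)" by (simp add: inj_on_def)
    show "inj_on node_name (Mor ?C)"
      unfolding tensor_def by (rule inj_on_node_name) (rule well_formed_axioms)
  qed
  have Phi: "free_pair (T L) (T R)"
    unfolding T_def by (intro free_pair.intro category_discrete)
  note 2 = left_equivalence_comp[OF 1 left_equivalence_tensor[OF L R]]
  note 3 = left_equivalence_comp[OF 2 free_pair.left_equivalence_Phi[OF Phi]]
  let ?inv = "\<lambda>t. case t of TPair x y \<Rightarrow> (x, y)"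
  have 4: "left_equivalence (FreeP (prod_cat (T L) (T R))) (FreeP (T (Node L R)))
     (FreeP_map (T (Node L R)) (\<lambda>(x, y). TPair x y) (\<lambda>(x, y). TPair x y))
     (FreeP_map (prod_cat (T L) (T R)) ?inv ?inv)
     (\<lambda>u. sumM (FreeP (prod_cat (T L) (T R))) (map (\<lambda>x. Idm (FreeP (prod_cat (T L) (T R))) [x]) u))"
  proof (rule left_equivalence_FreeP_map)
    show "category (prod_cat (T L) (T R))" "category (T (Node L R))"
      unfolding T_def by (intro category_prod category_discrete)+
  qed (auto simp: T_def discrete_def prod_cat_def)
  show ?case
    using left_equivalence_comp[OF 3 4] unfolding underlying.simps Pob.simps Phi_iter.simps
    by (auto simp: comp_func_def comp_assoc)
qed

theorem theorem7p12:
  fixes Q :: "('o, 'm) itensor" and k :: nat and \<kappa> \<kappa>' :: "('o, 'm) tmor"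
  assumes "iterated_tensor k Q"
    and "parallel (underlying Q) \<kappa> \<kappa>'"
    and "formal_pair Q \<kappa> \<kappa>'"
    and "same_underlying_permutation Q \<kappa> \<kappa>'"
  shows "\<kappa> = \<kappa>'"
proof -
  obtain l l' where l: "lift_pair Q \<kappa> \<kappa>' l l'" "Fm (Phi_iter Q) l = Fm (Phi_iter Q) l'"
    using assms(4) unfolding same_underlying_permutation_def by blast
  obtain G \<theta> where "left_equivalence (underlying (Pob Q)) (FreeP (T Q)) (Phi_iter Q) G \<theta>"
    using left_equivalence_Phi_iter by blast
  then have "l = l'"
    by (rule left_equivalence.faithful) (use l in \<open>auto simp: lift_pair_def\<close>)
  then show ?thesis using l(1) by (auto simp: lift_pair_def)
qed

end
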